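(* Let $\pi:E\to X$ be a diffeological vector pseudo-bundle. Then $\mathrm{Aut}(E)$ is a diffeological group, as a diffeological subgroup of $\mathrm{Diff}(E)$. Moreover, there is a short exact sequence $$0\to GL(E)\to \mathrm{Aut}(E)\to G_E(X)\to 0,$$ where the first map is the inclusion, the second is $(\phi,\varphi)\mapsto\varphi$, and $G_E(X)$ is a diffeological subgroup of $\mathrm{Diff}(X)$.
   Context: A diffeology on a set is a collection of parametrisations (plots; maps from open subsets of Euclidean spaces) containing constants, local, and stable under smooth reparametrisation; smooth maps are those sending plots to plots. For $f:(X,\mathcal P)\to X'$, the push-forward diffeology $f_*(\mathcal P)$ is the smallest (for inclusion) diffeology on $X'$ containing $f\circ\mathcal P$; $f:(X,\mathcal P)\to(X',\mathcal P')$ is a subduction if $\mathcal P'=f_*(\mathcal P)$. A diffeological vector pseudo-bundle over a diffeological field $\mathbb K$ is a smooth surjective subduction $\pi:E\to X$ of diffeological spaces with smooth fiberwise maps $\mathbb K\times E\to E$ (scalar multiplication) and $E^{(2)}=\{(u,v)\in E^2:\pi(u)=\pi(v)\}\to E$ (addition; $E^{(2)}$ has the diffeology pulled back from $E^2$), making each fiber $E_x=\pi^{-1}(x)$ a diffeological vector space. No local triviality and no typical fiber is assumed. A morphism from $\pi:E\to X$ to $\pi':F\to Y$ is a pair $(\phi,\varphi)$ of smooth maps $\phi:E\to F$, $\varphi:X\to Y$ with $\pi'\circ\phi=\varphi\circ\pi$ and $\phi|_{E_x}:E_x\to F_{\varphi(x)}$ linear for all $x$. $\mathrm{Aut}(E)$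 is the group of automorphisms $(\phi,\varphi)$ of $E$ (invertible morphisms $E\to E$), identified with the set of the $\phi$'s in $\mathrm{Diff}(E)$. $GL(E)$ is the group of automorphisms of $E$ which decompose fiberwise as an automorphism of each fiber, i.e. those with $\varphi=\mathrm{Id}_X$. $G_E(X)\subset \mathrm{Diff}(X)$ is the image of the projection $(\phi,\varphi)\mapsto\varphi$. $\mathrm{Diff}(Z)$ carries the functional diffeology for which evaluation and inversion are smooth: $\rho:U\to\mathrm{Diff}(Z)$ is a plot iff for each plot $p$ of $Z$ the maps $(t,u)\mapsto\rho(u)(p(t))$ and $(t,u)\mapsto\rho(u)^{-1}(p(t))$ are plots. A diffeological subgroup carries the subset diffeology. *)

theory Defs
  imports "HOL-Analysis.Analysis" "HOL-Algebra.Algebra"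
begin

section \<open>Smooth maps between open subsets of Euclidean spaces\<close>

text \<open>
  The dimension of a plot varies, so points of n-dimensional Euclidean space are functions
  \<open>nat \<Rightarrow> real\<close> vanishing from index \<open>n\<close> on, with the topology \<^const>\<open>Euclidean_space\<close>.
  Updating the coordinate \<open>i < n\<close> of such a point stays inside the space, so
  \<open>\<lambda>t. f (x(i := t))\<close> is \<open>f\<close> along the \<open>i\<close>-th coordinate line through \<open>x\<close>.
\<close>

definition partial_deriv :: "nat \<Rightarrow> ((nat \<Rightarrow> real) \<Rightarrow> real) \<Rightarrow> (nat \<Rightarrow> real) \<Rightarrow> real" where
  "partial_deriv i f x = deriv (\<lambda>t. f (x(i := t))) (x i)"

text \<open>\<open>C_diff k n U f\<close>: on the open set \<open>U\<close> of n-space, \<open>f\<close> is of class \<open>C\<^sup>k\<close>.\<close>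

primrec C_diff :: "nat \<Rightarrow> nat \<Rightarrow> (nat \<Rightarrow> real) set \<Rightarrow> ((nat \<Rightarrow> real) \<Rightarrow> real) \<Rightarrow> bool" where
  "C_diff 0 n U f \<longleftrightarrow> continuous_map (subtopology (Euclidean_space n) U) euclideanreal f"
| "C_diff (Suc k) n U f \<longleftrightarrow>
     continuous_map (subtopology (Euclidean_space n) U) euclideanreal f \<and>
     (\<forall>i<n. (\<forall>x\<in>U. (\<lambda>t. f (x(i := t))) differentiable at (x i)) \<and>
            C_diff k n U (partial_deriv i f))"

definition smooth_euclidean ::
  "nat \<Rightarrow> (nat \<Rightarrow> real) set \<Rightarrow> nat \<Rightarrow> (nat \<Rightarrow> real) set \<Rightarrow> ((nat \<Rightarrow> real) \<Rightarrow> (nat \<Rightarrow> real)) \<Rightarrow> bool"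
where
  "smooth_euclidean m V n U F \<longleftrightarrow> F \<in> V \<rightarrow> U \<and> (\<forall>j<n. \<forall>k. C_diff k m V (\<lambda>r. F r j))"


section \<open>Diffeological spaces\<close>

text \<open>
  A parametrisation is a triple \<open>(n, U, p)\<close> with \<open>U\<close> open in n-space and \<open>p\<close> a function on \<open>U\<close>,
  normalised to be \<^const>\<open>undefined\<close> off \<open>U\<close> so that sets of parametrisations can be compared.
\<close>

type_synonym 'a param = "nat \<times> (nat \<Rightarrow> real) set \<times> ((nat \<Rightarrow> real) \<Rightarrow> 'a)"

record 'a dspace =
  points :: "'a set"
  plots :: "'a param set"

locale diffeological_space =
  fixes A :: "'a dspace"
  assumes plots_param:
      "(n, U, p) \<in> plots A \<Longrightarrow> openin (Euclidean_space n) U \<and> p \<in> U \<rightarrow>\<^sub>E points A"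
    and plots_const:
      "openin (Euclidean_space n) U \<Longrightarrow> a \<in> points A \<Longrightarrow> (n, U, \<lambda>r\<in>U. a) \<in> plots A"
    and plots_local:
      "openin (Euclidean_space n) U \<Longrightarrow> p \<in> U \<rightarrow>\<^sub>E points A \<Longrightarrow>
       (\<And>r. r \<in> U \<Longrightarrow> \<exists>V. openin (Euclidean_space n) V \<and> r \<in> V \<and> V \<subseteq> U \<and>
                          (n, V, restrict p V) \<in> plots A) \<Longrightarrow>
       (n, U, p) \<in> plots A"
    and plots_reparam:
      "(n, U, p) \<in> plots A \<Longrightarrow> openin (Euclidean_space m) V \<Longrightarrow> smooth_euclidean m V n U F \<Longrightarrow>
       (m, V, compose V p F) \<in> plots A"

definition smooth_map :: "'a dspace \<Rightarrow> 'b dspace \<Rightarrow> ('a \<Rightarrow> 'b) \<Rightarrow> bool" where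
  "smooth_map A B f \<longleftrightarrow> f \<in> points A \<rightarrow> points B \<and>
     (\<forall>(n, U, p) \<in> plots A. (n, U, compose U f p) \<in> plots B)"

definition subset_space :: "'a dspace \<Rightarrow> 'a set \<Rightarrow> 'a dspace" where
  "subset_space A S = \<lparr>points = S, plots = {(n, U, p) \<in> plots A. p \<in> U \<rightarrow>\<^sub>E S}\<rparr>"

definition prod_space :: "'a dspace \<Rightarrow> 'b dspace \<Rightarrow> ('a \<times> 'b) dspace" where
  "prod_space A B =
     \<lparr>points = points A \<times> points B,
      plots = {(n, U, p). p \<in> U \<rightarrow>\<^sub>E points A \<times> points B \<and>
                 (n, U, compose U fst p) \<in> plots A \<and> (n, U, compose U snd p) \<in> plots B}\<rparr>"

text \<open>Push-forward: the smallest diffeology on \<open>S\<close> containing the composites of \<open>f\<close> with plots.\<close>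

definition pushforward :: "('a \<Rightarrow> 'b) \<Rightarrow> 'a dspace \<Rightarrow> 'b set \<Rightarrow> 'b param set" where
  "pushforward f A S =
     \<Inter> {D. diffeological_space \<lparr>points = S, plots = D\<rparr> \<and>
            (\<forall>(n, U, p) \<in> plots A. (n, U, compose U f p) \<in> D)}"

definition subduction :: "'a dspace \<Rightarrow> 'b dspace \<Rightarrow> ('a \<Rightarrow> 'b) \<Rightarrow> bool" where
  "subduction A B f \<longleftrightarrow>
     f \<in> points A \<rightarrow> points B \<and> plots B = pushforward f A (points B)"


section \<open>Diffeological groups, fields and vector spaces\<close>

locale diffeological_group =
  fixes G :: "('a, 'm) monoid_scheme" and A :: "'a dspace"
  assumes "group G" and "diffeological_space A" and "points A = carrier G"
    and "smooth_map (prod_space A A) A (\<lambda>(x, y). x \<otimes>\<^bsub>G\<^esub> y)"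
    and "smooth_map A A (\<lambda>x. inv\<^bsub>G\<^esub> x)"

definition diffeological_subgroup ::
  "'a set \<Rightarrow> ('a, 'm) monoid_scheme \<Rightarrow> 'a dspace \<Rightarrow> bool"
where
  "diffeological_subgroup H G A \<longleftrightarrow>
     diffeological_group G A \<and> subgroup H G \<and>
     diffeological_group (G\<lparr>carrier := H\<rparr>) (subset_space A H)"

locale diffeological_field =
  fixes K :: "('k, 'm) ring_scheme" and KD :: "'k dspace"
  assumes "field K" and "diffeological_space KD" and "points KD = carrier K"
    and "smooth_map (prod_space KD KD) KD (\<lambda>(a, b). a \<oplus>\<^bsub>K\<^esub> b)"
    and "smooth_map KD KD (\<lambda>a. \<ominus>\<^bsub>K\<^esub> a)"
    and "smooth_map (prod_space KD KD) KD (\<lambda>(a, b). a \<otimes>\<^bsub>K\<^esub> b)"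
    and "smooth_map (subset_space KD (carrier K - {\<zero>\<^bsub>K\<^esub>})) KD (\<lambda>a. inv\<^bsub>K\<^esub> a)"

locale diffeological_vector_space =
  fixes K :: "('k, 'm) ring_scheme" and KD :: "'k dspace"
    and M :: "('k, 'v) Module.module" and MD :: "'v dspace"
  assumes "Module.module K M" and "diffeological_space MD" and "points MD = carrier M"
    and "smooth_map (prod_space MD MD) MD (\<lambda>(u, v). u \<oplus>\<^bsub>M\<^esub> v)"
    and "smooth_map (prod_space KD MD) MD (\<lambda>(a, v). a \<odot>\<^bsub>M\<^esub> v)"

definition linear_map ::
  "('k, 'm) ring_scheme \<Rightarrow> ('k, 'v) Module.module \<Rightarrow> ('k, 'w) Module.module \<Rightarrow> ('v \<Rightarrow> 'w) \<Rightarrow> bool"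
where
  "linear_map K M N f \<longleftrightarrow> f \<in> carrier M \<rightarrow> carrier N \<and>
     (\<forall>u \<in> carrier M. \<forall>v \<in> carrier M. f (u \<oplus>\<^bsub>M\<^esub> v) = f u \<oplus>\<^bsub>N\<^esub> f v) \<and>
     (\<forall>a \<in> carrier K. \<forall>u \<in> carrier M. f (a \<odot>\<^bsub>M\<^esub> u) = a \<odot>\<^bsub>N\<^esub> f u)"


section \<open>Vector pseudo-bundles\<close>

record ('k, 'e, 'x) pseudo_bundle =
  total :: "'e dspace"
  base :: "'x dspace"
  proj :: "'e \<Rightarrow> 'x"
  badd :: "'e \<Rightarrow> 'e \<Rightarrow> 'e"
  bsmult :: "'k \<Rightarrow> 'e \<Rightarrow> 'e"
  bzero :: "'x \<Rightarrow> 'e"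

definition fiber :: "('k, 'e, 'x) pseudo_bundle \<Rightarrow> 'x \<Rightarrow> 'e set" where
  "fiber B x = {u \<in> points (total B). proj B u = x}"

text \<open>
  The record type of modules extends that of rings; its multiplicative fields play no role
  in \<^locale>\<open>Module.module\<close> and are left unspecified.
\<close>

definition fiber_module :: "('k, 'e, 'x) pseudo_bundle \<Rightarrow> 'x \<Rightarrow> ('k, 'e) Module.module" where
  "fiber_module B x =
     \<lparr>carrier = fiber B x, mult = undefined, one = undefined,
      ring.zero = bzero B x, ring.add = badd B, smult = bsmult B\<rparr>"

definition fiber_pairs :: "('k, 'e, 'x) pseudo_bundle \<Rightarrow> ('e \<times> 'e) set" where
  "fiber_pairs B = {(u, v) \<in> points (total B) \<times> points (total B). proj B u = proj B v}"

locale vector_pseudo_bundle =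
  fixes K :: "('k, 'm) ring_scheme" and KD :: "'k dspace"
    and B :: "('k, 'e, 'x) pseudo_bundle"
  assumes "diffeological_field K KD"
    and "diffeological_space (total B)" and "diffeological_space (base B)"
    and "smooth_map (total B) (base B) (proj B)"
    and "proj B ` points (total B) = points (base B)"
    and "subduction (total B) (base B) (proj B)"
    and "smooth_map (prod_space KD (total B)) (total B) (\<lambda>(a, u). bsmult B a u)"
    and "smooth_map (subset_space (prod_space (total B) (total B)) (fiber_pairs B)) (total B)
           (\<lambda>(u, v). badd B u v)"
    and "\<And>x. x \<in> points (base B) \<Longrightarrow>
           diffeological_vector_space K KD (fiber_module B x) (subset_space (total B) (fiber B x))"

definition bundle_morphism ::
  "('k, 'm) ring_scheme \<Rightarrow> ('k, 'e, 'x) pseudo_bundle \<Rightarrow> ('k, 'f, 'y) pseudo_bundle \<Rightarrow>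
   ('e \<Rightarrow> 'f) \<Rightarrow> ('x \<Rightarrow> 'y) \<Rightarrow> bool"
where
  "bundle_morphism K B C \<phi> f \<longleftrightarrow>
     smooth_map (total B) (total C) \<phi> \<and> smooth_map (base B) (base C) f \<and>
     (\<forall>u \<in> points (total B). proj C (\<phi> u) = f (proj B u)) \<and>
     (\<forall>x \<in> points (base B). linear_map K (fiber_module B x) (fiber_module C (f x)) \<phi>)"

text \<open>
  Automorphisms as pairs: the morphisms with an inverse morphism. Both components are taken
  extensional, as for \<^const>\<open>Bij\<close>, so that they are determined by their values on the carriers.
\<close>

definition Aut_pairs ::
  "('k, 'm) ring_scheme \<Rightarrow> ('k, 'e, 'x) pseudo_bundle \<Rightarrow> (('e \<Rightarrow> 'e) \<times> ('x \<Rightarrow> 'x)) set"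
where
  "Aut_pairs K B =
     {(\<phi>, f). \<phi> \<in> extensional (points (total B)) \<and> f \<in> extensional (points (base B)) \<and>
        bundle_morphism K B B \<phi> f \<and>
        (\<exists>\<psi> g. bundle_morphism K B B \<psi> g \<and>
           (\<forall>u \<in> points (total B). \<psi> (\<phi> u) = u \<and> \<phi> (\<psi> u) = u) \<and>
           (\<forall>x \<in> points (base B). g (f x) = x \<and> f (g x) = x))}"

definition Aut_set :: "('k, 'm) ring_scheme \<Rightarrow> ('k, 'e, 'x) pseudo_bundle \<Rightarrow> ('e \<Rightarrow> 'e) set" where
  "Aut_set K B = fst ` Aut_pairs K B"

definition GL_set :: "('k, 'm) ring_scheme \<Rightarrow> ('k, 'e, 'x) pseudo_bundle \<Rightarrow> ('e \<Rightarrow> 'e) set" where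
  "GL_set K B = {\<phi>. (\<phi>, \<lambda>x \<in> points (base B). x) \<in> Aut_pairs K B}"

definition GE_set :: "('k, 'm) ring_scheme \<Rightarrow> ('k, 'e, 'x) pseudo_bundle \<Rightarrow> ('x \<Rightarrow> 'x) set" where
  "GE_set K B = snd ` Aut_pairs K B"

text \<open>The second projection, read on first components: \<open>f\<close> is determined by \<open>\<phi>\<close>
  because the bundle projection is surjective.\<close>

definition base_part ::
  "('k, 'm) ring_scheme \<Rightarrow> ('k, 'e, 'x) pseudo_bundle \<Rightarrow> ('e \<Rightarrow> 'e) \<Rightarrow> ('x \<Rightarrow> 'x)"
where
  "base_part K B \<phi> = (THE f. (\<phi>, f) \<in> Aut_pairs K B)"


section \<open>Diffeomorphism groups with the functional diffeology\<close>

definition Diff :: "'a dspace \<Rightarrow> ('a \<Rightarrow> 'a) monoid" where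
  "Diff A = (BijGroup (points A))
     \<lparr>carrier := {f \<in> Bij (points A). smooth_map A A f \<and> smooth_map A A (inv_into (points A) f)}\<rparr>"

text \<open>
  A point \<open>w\<close> of (m+n)-space is read as the pair of \<open>lo_part m w\<close> in m-space and
  \<open>hi_part m w\<close> in n-space; \<open>euclid_times m V n U\<close> is the product of \<open>V\<close> and \<open>U\<close>.
\<close>

definition lo_part :: "nat \<Rightarrow> (nat \<Rightarrow> real) \<Rightarrow> (nat \<Rightarrow> real)" where
  "lo_part m w = (\<lambda>i. if i < m then w i else 0)"

definition hi_part :: "nat \<Rightarrow> (nat \<Rightarrow> real) \<Rightarrow> (nat \<Rightarrow> real)" where
  "hi_part m w = (\<lambda>i. w (m + i))"

definition euclid_times ::
  "nat \<Rightarrow> (nat \<Rightarrow> real) set \<Rightarrow> nat \<Rightarrow> (nat \<Rightarrow> real) set \<Rightarrow> (nat \<Rightarrow> real) set"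
where
  "euclid_times m V n U =
     {w \<in> topspace (Euclidean_space (m + n)). lo_part m w \<in> V \<and> hi_part m w \<in> U}"

definition Diff_space :: "'a dspace \<Rightarrow> ('a \<Rightarrow> 'a) dspace" where
  "Diff_space A =
     \<lparr>points = carrier (Diff A),
      plots = {(n, U, \<rho>). openin (Euclidean_space n) U \<and> \<rho> \<in> U \<rightarrow>\<^sub>E carrier (Diff A) \<and>
        (\<forall>(m, V, p) \<in> plots A.
           (m + n, euclid_times m V n U,
              \<lambda>w \<in> euclid_times m V n U. \<rho> (hi_part m w) (p (lo_part m w))) \<in> plots A \<and>
           (m + n, euclid_times m V n U,
              \<lambda>w \<in> euclid_times m V n U.
                inv_into (points A) (\<rho> (hi_part m w)) (p (lo_part m w))) \<in> plots A)}\<rparr>"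


section \<open>Short exact sequences\<close>

text \<open>
  \<^const>\<open>short_exact_sequence\<close> forces all groups onto one element type; this is the
  characterisation \<open>short_exact_sequence_iff\<close> with independent types, for the sequence
  \<open>1 \<rightarrow> G \<rightarrow> H \<rightarrow> L \<rightarrow> 1\<close> with maps \<open>i\<close> and \<open>q\<close>.
\<close>

definition short_exact ::
  "('a, 'm) monoid_scheme \<Rightarrow> ('b, 'n) monoid_scheme \<Rightarrow> ('c, 'l) monoid_scheme \<Rightarrow>
   ('a \<Rightarrow> 'b) \<Rightarrow> ('b \<Rightarrow> 'c) \<Rightarrow> bool"
where
  "short_exact G H L i q \<longleftrightarrow> group G \<and> group H \<and> group L \<and>
     i \<in> mon G H \<and> q \<in> epi H L \<and> kernel H L q = i ` carrier G"

end

theory Submission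
  imports Defs
begin

text \<open>
  Plots of \<open>Diff(Z)\<close> are the families whose evaluation map, and that of the inverse family,
  send plots of \<open>Z\<close> to plots. The evaluation map of a product \<open>\<rho> \<sigma>\<close> is obtained by evaluating
  \<open>\<rho>\<close> along the plot \<open>(t, u) \<mapsto> \<sigma>(u)(p(t))\<close> and restricting the parameters to the diagonal
  \<open>(t, u) \<mapsto> ((t, u), u)\<close>. The reparametrisations needed are coordinate maps and
  products \<open>id \<times> F\<close> with \<open>F\<close> smooth, so no chain rule is involved.

  An automorphism \<open>(\<phi>, f)\<close> satisfies \<open>\<pi> \<circ> \<phi> = f \<circ> \<pi>\<close> with \<open>\<pi>\<close> onto, hence \<open>\<phi>\<close> determines \<open>f\<close>.
  Plots of the base lift locally along the subduction \<open>\<pi>\<close>, so the evaluation map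
  \<open>(t, u) \<mapsto> f\<^sub>u(p(t))\<close> is locally \<open>\<pi>(\<phi>\<^sub>u(q(t)))\<close> for a lift \<open>q\<close> of \<open>p\<close>; this makes \<open>\<phi> \<mapsto> f\<close> smooth.
\<close>

section \<open>Smooth maps of Euclidean domains\<close>

lemma openin_Euclidean_space_subset:
  "openin (Euclidean_space n) U \<Longrightarrow> x \<in> U \<Longrightarrow> i \<ge> n \<Longrightarrow> x i = 0"
  using openin_subset[of "Euclidean_space n" U] by (auto simp: topspace_Euclidean_space)

text \<open>The componentwise criterion concerns maps truncated at index \<open>n\<close>; the
  vanishing hypothesis makes \<open>F\<close> agree with its truncation.\<close>

lemma continuous_map_into_Euclidean_space:
  assumes "\<And>x i. x \<in> topspace T \<Longrightarrow> i \<ge> n \<Longrightarrow> F x i = 0"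
    and "\<And>i. i < n \<Longrightarrow> continuous_map T euclideanreal (\<lambda>x. F x i)"
  shows "continuous_map T (Euclidean_space n) F"
proof -
  have "continuous_map T (Euclidean_space n) (\<lambda>x i. if i < n then F x i else 0)"
    using assms(2) by (simp add: continuous_map_componentwise_Euclidean_space)
  then show ?thesis
    by (rule continuous_map_eq) (use assms(1) in \<open>auto simp: fun_eq_iff\<close>)
qed

lemma continuous_map_Euclidean_coordinate:
  "continuous_map (subtopology (Euclidean_space n) U) euclideanreal (\<lambda>x. x i)"
  unfolding Euclidean_space_def
  by (intro continuous_map_from_subtopology continuous_map_product_projection) simp

section \<open>Elementary functions of class C^k\<close>

lemma C_diff_continuous:
  "C_diff k n U f \<Longrightarrow> continuous_map (subtopology (Euclidean_space n) U) euclideanreal f"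
  by (cases k) auto

text \<open>\<open>partial_deriv\<close> does not mention the domain, so shrinking the domain keeps
  the same iterated partial derivatives and only affects continuity and pointwise
  differentiability.\<close>

lemma C_diff_subset: "C_diff k n U f \<Longrightarrow> W \<subseteq> U \<Longrightarrow> C_diff k n W f"
proof (induction k arbitrary: f)
  case 0
  then show ?case by (auto intro: continuous_map_from_subtopology_mono)
next
  case (Suc k)
  then show ?case
    by (fastforce intro: continuous_map_from_subtopology_mono)
qed

lemma C_diff_const: "C_diff k n U (\<lambda>_. c)"
proof (induction k arbitrary: c)
  case (Suc k)
  have "partial_deriv i (\<lambda>_. c) = (\<lambda>_. 0)" for i
    by (simp add: partial_deriv_def fun_eq_iff)
  with Suc show ?case by simp
qed simp

text \<open>All partial derivatives are the constants 0 or 1, so a case distinction on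
  \<open>k\<close> suffices.\<close>

lemma C_diff_coordinate: "C_diff k n U (\<lambda>x. x j)"
proof (cases k)
  case (Suc l)
  have "partial_deriv i (\<lambda>x. x j) = (\<lambda>_. if i = j then 1 else 0)" for i
    by (auto simp: partial_deriv_def fun_eq_iff)
  moreover have "(\<lambda>t. (x(i := t)) j) differentiable at (x i)" for x :: "nat \<Rightarrow> real" and i
    by (cases "i = j") auto
  ultimately show ?thesis
    by (simp add: Suc C_diff_const continuous_map_Euclidean_coordinate del: fun_upd_apply)
qed (simp add: continuous_map_Euclidean_coordinate)

section \<open>Composition with the second projection of a product domain\<close>

lemma hi_part_upd: "hi_part m (w(i := t)) = (if i < m then hi_part m w else (hi_part m w)(i - m := t))"
  by (auto simp: hi_part_def fun_eq_iff)

lemma continuous_map_hi_part: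
  "continuous_map (subtopology (Euclidean_space (m + n)) (euclid_times m V n U))
     (subtopology (Euclidean_space n) U) (hi_part m)"
  unfolding continuous_map_in_subtopology
proof
  show "continuous_map (subtopology (Euclidean_space (m + n)) (euclid_times m V n U))
      (Euclidean_space n) (hi_part m)"
    by (rule continuous_map_into_Euclidean_space)
      (auto simp: hi_part_def topspace_Euclidean_space continuous_map_Euclidean_coordinate)
qed (auto simp: euclid_times_def)

text \<open>Moving a coordinate below \<open>m\<close> leaves \<open>hi_part m w\<close> fixed;
  moving a coordinate \<open>i \<ge> m\<close> moves exactly the coordinate \<open>i - m\<close> of
  \<open>hi_part m w\<close>. Each partial derivative is therefore 0 or of the same form with
  \<open>partial_deriv (i - m) f\<close>, and the induction closes.\<close>

lemma C_diff_hi_part: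
  "C_diff k n U f \<Longrightarrow> C_diff k (m + n) (euclid_times m V n U) (\<lambda>w. f (hi_part m w))"
proof (induction k arbitrary: f)
  case 0
  then show ?case
    using continuous_map_compose[OF continuous_map_hi_part] by (fastforce simp: o_def)
next
  case (Suc k)
  have cont: "continuous_map (subtopology (Euclidean_space (m + n)) (euclid_times m V n U))
      euclideanreal (\<lambda>w. f (hi_part m w))"
    using continuous_map_compose[OF continuous_map_hi_part C_diff_continuous[OF Suc.prems]]
    by (simp add: o_def)
  have "(\<forall>w\<in>euclid_times m V n U. (\<lambda>t. f (hi_part m (w(i := t)))) differentiable at (w i)) \<and>
      C_diff k (m + n) (euclid_times m V n U) (partial_deriv i (\<lambda>w. f (hi_part m w)))"
    if "i < m + n" for i
  proof (cases "i < m")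
    case True
    then have "partial_deriv i (\<lambda>w. f (hi_part m w)) = (\<lambda>_. 0)"
      by (simp add: partial_deriv_def hi_part_upd fun_eq_iff)
    with True show ?thesis
      by (simp add: hi_part_upd C_diff_const)
  next
    case False
    \<comment> \<open>Derivatives of \<open>f\<close> are taken at a coordinate of its own argument,
      so the value \<open>w i\<close> has to be recognised as one.\<close>
    then have w: "hi_part m w (i - m) = w i" for w
      by (simp add: hi_part_def)
    have "partial_deriv i (\<lambda>w. f (hi_part m w)) = (\<lambda>w. partial_deriv (i - m) f (hi_part m w))"
      using False by (simp add: partial_deriv_def hi_part_upd w fun_eq_iff)
    moreover have "(\<lambda>t. f ((hi_part m x)(i - m := t))) differentiable at (x i)"
      if "x \<in> euclid_times m V n U" for x
      using Suc.prems that \<open>i < m + n\<close> False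
      by (force simp: euclid_times_def w[symmetric])
    ultimately show ?thesis
      using Suc that False by (auto simp: hi_part_upd)
  qed
  with cont show ?case by simp
qed

section \<open>Continuity of smooth maps and the basic reparametrisations\<close>

lemma smooth_euclidean_continuous:
  assumes "openin (Euclidean_space m) V" "openin (Euclidean_space n) U"
    and F: "smooth_euclidean m V n U F"
  shows "continuous_map (subtopology (Euclidean_space m) V) (subtopology (Euclidean_space n) U) F"
proof -
  have VU: "F \<in> V \<rightarrow> U" and C: "\<And>j. j < n \<Longrightarrow> C_diff 0 m V (\<lambda>r. F r j)"
    using F unfolding smooth_euclidean_def by blast+
  have "continuous_map (subtopology (Euclidean_space m) V) (Euclidean_space n) F"
  proof (rule continuous_map_into_Euclidean_space)
    show "F x i = 0" if "x \<in> topspace (subtopology (Euclidean_space m) V)" "n \<le> i" for x i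
      using that VU openin_Euclidean_space_subset[OF assms(2)] by auto
  qed (use C in auto)
  then show ?thesis
    using VU by (auto simp: continuous_map_in_subtopology)
qed

text \<open>A local lift of a plot lives on some open \<open>W\<close>; to reparametrise it by
  \<open>F\<close>, the points that \<open>F\<close> sends into \<open>W\<close> must again form a
  plot domain.\<close>

lemma smooth_euclidean_preimage:
  assumes "openin (Euclidean_space m) V" "openin (Euclidean_space n) U"
    and "smooth_euclidean m V n U F" and "openin (Euclidean_space n) W"
  shows "openin (Euclidean_space m) {x \<in> V. F x \<in> W}"
proof -
  have "continuous_map (subtopology (Euclidean_space m) V) (Euclidean_space n) F"
    using smooth_euclidean_continuous[OF assms(1-3)] by (simp add: continuous_map_in_subtopology)
  from openin_continuous_map_preimage[OF this assms(4)]
  have "openin (subtopology (Euclidean_space m) V) {x \<in> topspace (Euclidean_space m) \<inter> V. F x \<in> W}"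
    by simp
  moreover have "topspace (Euclidean_space m) \<inter> V = V"
    using openin_subset[OF assms(1)] by auto
  ultimately show ?thesis
    using assms(1) by (simp add: openin_open_subtopology)
qed

lemma smooth_euclidean_subset:
  "smooth_euclidean m V n U F \<Longrightarrow> V' \<subseteq> V \<Longrightarrow> F \<in> V' \<rightarrow> U' \<Longrightarrow> smooth_euclidean m V' n U' F"
  unfolding smooth_euclidean_def by (blast intro: C_diff_subset)

lemma openin_euclid_times:
  assumes "openin (Euclidean_space m) V" "openin (Euclidean_space n) U"
  shows "openin (Euclidean_space (m + n)) (euclid_times m V n U)"
proof -
  have "continuous_map (Euclidean_space (m + n)) (Euclidean_space m) (lo_part m)"
    using continuous_map_Euclidean_coordinate[of "m + n" UNIV]
    by (intro continuous_map_into_Euclidean_space) (auto simp: lo_part_def)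
  moreover have "continuous_map (Euclidean_space (m + n)) (Euclidean_space n) (hi_part m)"
    using continuous_map_Euclidean_coordinate[of "m + n" UNIV]
    by (intro continuous_map_into_Euclidean_space) (auto simp: hi_part_def topspace_Euclidean_space)
  moreover have "euclid_times m V n U =
      {w \<in> topspace (Euclidean_space (m + n)). lo_part m w \<in> V} \<inter>
      {w \<in> topspace (Euclidean_space (m + n)). hi_part m w \<in> U}"
    by (auto simp: euclid_times_def)
  ultimately show ?thesis
    using assms by (auto intro!: openin_Int openin_continuous_map_preimage)
qed

lemma smooth_lo_part: "smooth_euclidean (m + n) (euclid_times m V n U) m V (lo_part m)"
  by (auto simp: smooth_euclidean_def euclid_times_def lo_part_def C_diff_coordinate)

lemma euclid_times_mono: "V \<subseteq> V' \<Longrightarrow> U \<subseteq> U' \<Longrightarrow> euclid_times m V n U \<subseteq> euclid_times m V' n U'"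
  by (auto simp: euclid_times_def)

text \<open>\<open>id \<times> F\<close> in the coordinates of \<^const>\<open>euclid_times\<close>.\<close>

definition times_right :: "nat \<Rightarrow> ((nat \<Rightarrow> real) \<Rightarrow> nat \<Rightarrow> real) \<Rightarrow> (nat \<Rightarrow> real) \<Rightarrow> nat \<Rightarrow> real" where
  "times_right m F w = (\<lambda>i. if i < m then w i else F (hi_part m w) (i - m))"

lemma lo_part_times_right [simp]: "lo_part m (times_right m F w) = lo_part m w"
  by (auto simp: times_right_def lo_part_def fun_eq_iff)

lemma hi_part_times_right [simp]: "hi_part m (times_right m F w) = F (hi_part m w)"
  by (auto simp: times_right_def hi_part_def fun_eq_iff)

lemma smooth_times_right:
  assumes U: "openin (Euclidean_space n) U" and F: "smooth_euclidean l W n U F"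
  shows "smooth_euclidean (m + l) (euclid_times m V l W) (m + n) (euclid_times m V n U)
           (times_right m F)"
  unfolding smooth_euclidean_def
proof (intro conjI allI impI)
  have FWU: "F \<in> W \<rightarrow> U"
    using F by (simp add: smooth_euclidean_def)
  show "times_right m F \<in> euclid_times m V l W \<rightarrow> euclid_times m V n U"
  proof
    fix w assume w: "w \<in> euclid_times m V l W"
    then have Fw: "F (hi_part m w) \<in> U"
      using FWU by (auto simp: euclid_times_def)
    \<comment> \<open>From index \<open>m + n\<close> on, \<open>times_right\<close> reads a value
      of \<open>F\<close> at indices \<open>i - m \<ge> n\<close>, where points of \<open>U\<close>
      vanish.\<close>
    have "times_right m F w i = 0" if "i \<ge> m + n" for i
      using that openin_Euclidean_space_subset[OF U Fw, of "i - m"] by (simp add: times_right_def)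
    with w Fw show "times_right m F w \<in> euclid_times m V n U"
      by (simp add: euclid_times_def topspace_Euclidean_space)
  qed
  show "C_diff k (m + l) (euclid_times m V l W) (\<lambda>r. times_right m F r j)" if "j < m + n" for j k
  proof (cases "j < m")
    case False
    then have "j - m < n"
      using that by simp
    then have "C_diff k l W (\<lambda>r. F r (j - m))"
      using F by (simp add: smooth_euclidean_def)
    from C_diff_hi_part[OF this] False show ?thesis
      by (simp add: times_right_def)
  qed (simp add: times_right_def C_diff_coordinate)
qed

text \<open>The map \<open>(v, u) \<mapsto> ((v, u), u)\<close> in the coordinates of \<^const>\<open>euclid_times\<close>.\<close>

definition dup_hi :: "nat \<Rightarrow> nat \<Rightarrow> (nat \<Rightarrow> real) \<Rightarrow> nat \<Rightarrow> real" where
  "dup_hi m n w = (\<lambda>i. if i < m + n then w i else w (i - n))"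

text \<open>\<open>lo_part\<close> cuts off at index \<open>m + n\<close>, which changes nothing
  when \<open>w\<close> already vanishes from there on.\<close>

lemma lo_part_dup_hi: "w \<in> topspace (Euclidean_space (m + n)) \<Longrightarrow> lo_part (m + n) (dup_hi m n w) = w"
  by (auto simp: dup_hi_def lo_part_def topspace_Euclidean_space fun_eq_iff)

lemma hi_part_dup_hi: "hi_part (m + n) (dup_hi m n w) = hi_part m w"
  by (auto simp: dup_hi_def hi_part_def fun_eq_iff)

text \<open>Every coordinate of \<open>dup_hi m n w\<close> is some coordinate of
  \<open>w\<close>.\<close>

lemma smooth_dup_hi:
  "smooth_euclidean (m + n) (euclid_times m V n U)
     (m + n + n) (euclid_times (m + n) (euclid_times m V n U) n U) (dup_hi m n)"
  unfolding smooth_euclidean_def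
proof (intro conjI allI impI)
  show "dup_hi m n \<in> euclid_times m V n U \<rightarrow> euclid_times (m + n) (euclid_times m V n U) n U"
  proof
    fix w assume w: "w \<in> euclid_times m V n U"
    then have "w \<in> topspace (Euclidean_space (m + n))"
      by (simp add: euclid_times_def)
    moreover from this have "dup_hi m n w \<in> topspace (Euclidean_space (m + n + n))"
      by (auto simp: dup_hi_def topspace_Euclidean_space)
    ultimately show "dup_hi m n w \<in> euclid_times (m + n) (euclid_times m V n U) n U"
      using w by (auto simp: euclid_times_def[of "m + n"] lo_part_dup_hi hi_part_dup_hi)
        (simp add: euclid_times_def)
  qed
  show "C_diff k (m + n) (euclid_times m V n U) (\<lambda>r. dup_hi m n r j)" for j k
    by (cases "j < m + n") (simp_all add: dup_hi_def C_diff_coordinate)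
qed

section \<open>Diffeological spaces\<close>

lemma smooth_mapI:
  assumes "f \<in> points A \<rightarrow> points B"
    and "\<And>n U p. (n, U, p) \<in> plots A \<Longrightarrow> (n, U, compose U f p) \<in> plots B"
  shows "smooth_map A B f"
  using assms by (auto simp: smooth_map_def)

lemma smooth_mapD:
  assumes "smooth_map A B f"
  shows "f \<in> points A \<rightarrow> points B"
    and "(n, U, p) \<in> plots A \<Longrightarrow> (n, U, compose U f p) \<in> plots B"
  using assms by (auto simp: smooth_map_def)

context diffeological_space begin

text \<open>The composite in the axiom is normalised off \<open>V\<close>; for an extensional
  \<open>q\<close> it can be recognised from its values on \<open>V\<close> alone.\<close>

lemma plots_reparam':
  assumes "(n, U, p) \<in> plots A" "openin (Euclidean_space m) V" "smooth_euclidean m V n U F"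
    and "\<And>r. r \<in> V \<Longrightarrow> q r = p (F r)" and "q \<in> extensional V"
  shows "(m, V, q) \<in> plots A"
proof -
  have "q = compose V p F"
    using assms(4,5) by (auto simp: compose_def extensional_def fun_eq_iff)
  with plots_reparam[OF assms(1-3)] show ?thesis by simp
qed

text \<open>Locality for the case where the local plots are built separately and only afterwards
  compared with \<open>p\<close>.\<close>

lemma plots_glue:
  assumes "openin (Euclidean_space n) U" "p \<in> extensional U"
    and loc: "\<And>r. r \<in> U \<Longrightarrow> \<exists>V q. openin (Euclidean_space n) V \<and> r \<in> V \<and> V \<subseteq> U \<and>
                (n, V, q) \<in> plots A \<and> (\<forall>x\<in>V. p x = q x)"
  shows "(n, U, p) \<in> plots A"
proof (rule plots_local[OF assms(1)])
  have "p x \<in> points A" if "x \<in> U" for x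
  proof -
    obtain V q where "x \<in> V" "(n, V, q) \<in> plots A" "p x = q x"
      using loc[OF \<open>x \<in> U\<close>] by blast
    then show ?thesis
      using plots_param by fastforce
  qed
  then show "p \<in> U \<rightarrow>\<^sub>E points A"
    using assms(2) by (auto simp: PiE_def)
  fix r assume "r \<in> U"
  then obtain V q where V: "openin (Euclidean_space n) V" "r \<in> V" "V \<subseteq> U"
    "(n, V, q) \<in> plots A" "\<forall>x\<in>V. p x = q x"
    using loc by blast
  \<comment> \<open>Plots are extensional, so agreement on \<open>V\<close> already gives
    equality.\<close>
  moreover have "restrict p V = q"
    using V(5) plots_param[OF V(4)] by (auto simp: fun_eq_iff extensional_def PiE_def)
  ultimately show "\<exists>V. openin (Euclidean_space n) V \<and> r \<in> V \<and> V \<subseteq> U \<and>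
      (n, V, restrict p V) \<in> plots A"
    by auto
qed

lemma smooth_map_id: "smooth_map A A (\<lambda>x. x)"
proof -
  have "compose U (\<lambda>x. x) p = p" if "(n, U, p) \<in> plots A" for n U p
    using plots_param[OF that] by (auto simp: compose_def fun_eq_iff PiE_def extensional_def)
  then show ?thesis
    by (auto simp: smooth_map_def)
qed

text \<open>Plots take values in \<open>points A\<close>, so values elsewhere never enter. This
  absorbs the differences between maps and their versions normalised by \<open>restrict\<close> or
  \<open>compose\<close>.\<close>

lemma smooth_map_cong:
  assumes "smooth_map A B f" "\<And>x. x \<in> points A \<Longrightarrow> f x = g x"
  shows "smooth_map A B g"
proof -
  have "compose U g p = compose U f p" if "(n, U, p) \<in> plots A" for n U p
    using plots_param[OF that] assms(2) by (fastforce simp: compose_def)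
  with smooth_mapD[OF assms(1)] assms(2) show ?thesis
    by (intro smooth_mapI) (auto simp: Pi_iff)
qed

section \<open>Subset spaces, products and diffeological subgroups\<close>

lemma subset_space_diffeological:
  assumes "S \<subseteq> points A"
  shows "diffeological_space (subset_space A S)"
proof
  fix n U and p :: "(nat \<Rightarrow> real) \<Rightarrow> 'a"
  assume U: "openin (Euclidean_space n) U" and p: "p \<in> U \<rightarrow>\<^sub>E points (subset_space A S)"
    and loc: "\<And>r. r \<in> U \<Longrightarrow> \<exists>V. openin (Euclidean_space n) V \<and> r \<in> V \<and> V \<subseteq> U \<and>
                          (n, V, restrict p V) \<in> plots (subset_space A S)"
  have "(n, U, p) \<in> plots A"
  proof (rule plots_local[OF U])
    show "p \<in> U \<rightarrow>\<^sub>E points A"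
      using p assms by (auto simp: subset_space_def)
    show "\<exists>V. openin (Euclidean_space n) V \<and> r \<in> V \<and> V \<subseteq> U \<and> (n, V, restrict p V) \<in> plots A"
      if "r \<in> U" for r
      using loc[OF that] by (auto simp: subset_space_def)
  qed
  with p show "(n, U, p) \<in> plots (subset_space A S)"
    by (simp add: subset_space_def)
next
  fix n U p m V F
  assume "(n, U, p) \<in> plots (subset_space A S)" "openin (Euclidean_space m) V"
    and F: "smooth_euclidean m V n U F"
  then show "(m, V, compose V p F) \<in> plots (subset_space A S)"
    using plots_reparam[of n U p m V F] F
    by (auto simp: subset_space_def smooth_euclidean_def compose_def)
qed (use assms plots_param plots_const in \<open>auto simp: subset_space_def\<close>)

end

lemma smooth_map_comp:
  assumes "smooth_map A B f" "smooth_map B C g"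
  shows "smooth_map A C (\<lambda>x. g (f x))"
proof -
  have "compose U (\<lambda>x. g (f x)) p = compose U g (compose U f p)" for U :: "(nat \<Rightarrow> real) set" and p
    by (auto simp: compose_def)
  with smooth_mapD[OF assms(1)] smooth_mapD[OF assms(2)] show ?thesis
    by (intro smooth_mapI) (auto simp: Pi_iff)
qed

lemma smooth_map_subset_space:
  assumes "smooth_map A B f" "S \<subseteq> points A" "f \<in> S \<rightarrow> T"
  shows "smooth_map (subset_space A S) (subset_space B T) f"
proof -
  have "compose U f p \<in> U \<rightarrow>\<^sub>E T" if "p \<in> U \<rightarrow>\<^sub>E S" for U :: "(nat \<Rightarrow> real) set" and p
    using that assms(3) by (auto simp: compose_def)
  with assms show ?thesis
    by (intro smooth_mapI) (auto simp: subset_space_def dest: smooth_mapD)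
qed

text \<open>Multiplication on a subgroup lives on a product of subset spaces; this turns it into a
  restriction of the ambient multiplication, to which \<open>smooth_map_subset_space\<close>
  applies.\<close>

lemma prod_subset_space:
  assumes "S \<subseteq> points A" "T \<subseteq> points B"
  shows "prod_space (subset_space A S) (subset_space B T) = subset_space (prod_space A B) (S \<times> T)"
proof -
  have *: "p \<in> U \<rightarrow>\<^sub>E points A \<times> points B" "compose U fst p \<in> U \<rightarrow>\<^sub>E S" "compose U snd p \<in> U \<rightarrow>\<^sub>E T"
    if "p \<in> U \<rightarrow>\<^sub>E S \<times> T" for U :: "(nat \<Rightarrow> real) set" and p
    using PiE_mem[OF that] that assms by (auto simp: compose_def PiE_iff mem_Times_iff)
  have "(p \<in> U \<rightarrow>\<^sub>E S \<times> T \<and> ((n, U, compose U fst p) \<in> plots A \<and> compose U fst p \<in> U \<rightarrow>\<^sub>E S) \<and>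
        (n, U, compose U snd p) \<in> plots B \<and> compose U snd p \<in> U \<rightarrow>\<^sub>E T) \<longleftrightarrow>
      (p \<in> U \<rightarrow>\<^sub>E points A \<times> points B \<and> (n, U, compose U fst p) \<in> plots A \<and>
        (n, U, compose U snd p) \<in> plots B) \<and> p \<in> U \<rightarrow>\<^sub>E S \<times> T" for n U p
    using *[of p U] by argo
  then show ?thesis
    by (simp add: prod_space_def subset_space_def)
qed

text \<open>Both operations of a subgroup are restrictions of smooth ambient operations, so only
  algebraic closure remains to be checked in each application.\<close>

lemma diffeological_subgroupI:
  assumes GA: "diffeological_group G A" and H: "subgroup H G"
  shows "diffeological_subgroup H G A"
proof -
  interpret group G using GA by (simp add: diffeological_group_def)
  interpret diffeological_space A using GA by (simp add: diffeological_group_def)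
  have pts: "points A = carrier G"
    and mult: "smooth_map (prod_space A A) A (\<lambda>(x, y). x \<otimes>\<^bsub>G\<^esub> y)"
    and inv: "smooth_map A A (\<lambda>x. inv\<^bsub>G\<^esub> x)"
    using GA by (simp_all add: diffeological_group_def)
  have HA: "H \<subseteq> points A"
    using H pts by (simp add: subgroup.subset)
  have "diffeological_group (G\<lparr>carrier := H\<rparr>) (subset_space A H)"
    unfolding diffeological_group_def
  proof (intro conjI)
    have S: "diffeological_space (subset_space A H)"
      by (rule subset_space_diffeological[OF HA])
    then show "diffeological_space (subset_space A H)" .
    show "group (G\<lparr>carrier := H\<rparr>)"
      by (rule subgroup_imp_group[OF H])
    show "points (subset_space A H) = carrier (G\<lparr>carrier := H\<rparr>)"
      by (simp add: subset_space_def)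
    show "smooth_map (prod_space (subset_space A H) (subset_space A H)) (subset_space A H)
        (\<lambda>(x, y). x \<otimes>\<^bsub>G\<lparr>carrier := H\<rparr>\<^esub> y)"
      unfolding prod_subset_space[OF HA HA]
      using HA by (auto intro!: smooth_map_subset_space mult simp: subgroup.m_closed[OF H])
        (auto simp: prod_space_def)
    \<comment> \<open>The ambient inverse and that of the subgroup are compared only on
      \<open>H\<close>, which is all that the congruence step asks for.\<close>
    have "smooth_map (subset_space A H) (subset_space A H) (\<lambda>x. inv\<^bsub>G\<^esub> x)"
      by (auto intro!: smooth_map_subset_space inv HA simp: subgroup.m_inv_closed[OF H])
    then show "smooth_map (subset_space A H) (subset_space A H) (\<lambda>x. inv\<^bsub>G\<lparr>carrier := H\<rparr>\<^esub> x)"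
      by (rule diffeological_space.smooth_map_cong[OF S])
        (simp add: subset_space_def m_inv_consistent[OF H])
  qed
  with GA H show ?thesis
    by (simp add: diffeological_subgroup_def)
qed

section \<open>The diffeomorphism group\<close>

lemma mem_Diff:
  "f \<in> carrier (Diff A) \<longleftrightarrow>
     f \<in> Bij (points A) \<and> smooth_map A A f \<and> smooth_map A A (inv_into (points A) f)"
  by (simp add: Diff_def)

lemma one_Diff: "\<one>\<^bsub>Diff A\<^esub> = (\<lambda>x\<in>points A. x)"
  by (simp add: Diff_def BijGroup_def)

lemma mult_Diff:
  "f \<in> carrier (Diff A) \<Longrightarrow> g \<in> carrier (Diff A) \<Longrightarrow> f \<otimes>\<^bsub>Diff A\<^esub> g = compose (points A) f g"
  by (simp add: Diff_def BijGroup_def)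

lemma inv_into_cancel:
  assumes "bij_betw f S S" "x \<in> S"
  shows "inv_into S f x \<in> S" "f (inv_into S f x) = x" "inv_into S f (f x) = x"
  using assms by (auto simp: bij_betw_def inv_into_into f_inv_into_f)

lemma Diff_bij:
  assumes "f \<in> carrier (Diff A)"
  shows "bij_betw f (points A) (points A)"
  using assms by (simp add: mem_Diff Bij_def)

lemmas Diff_inv_into = inv_into_cancel[OF Diff_bij]

lemma Diff_closed: "f \<in> carrier (Diff A) \<Longrightarrow> x \<in> points A \<Longrightarrow> f x \<in> points A"
  using Diff_bij bij_betw_apply by fast

lemma inv_into_compose_eq:
  assumes "bij_betw f S S" "bij_betw g S S" "x \<in> S"
  shows "inv_into S (compose S f g) x = inv_into S g (inv_into S f x)"
proof -
  have "bij_betw (compose S f g) S S"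
    using assms by (simp add: bij_betw_compose)
  then show ?thesis
    using inv_into_cancel[OF assms(1)] inv_into_cancel[OF assms(2)] assms(3)
    by (intro inv_into_f_eq) (auto simp: compose_eq bij_betw_def)
qed

text \<open>The group inverse is \<open>inv_into\<close> restricted to \<open>S\<close>; undoing it
  returns \<open>f\<close>, which supplies the second smoothness condition for an inverse.\<close>

lemma inv_into_inv_eq:
  assumes "bij_betw f S S" "x \<in> S"
  shows "inv_into S (\<lambda>x\<in>S. inv_into S f x) x = f x"
  using assms inv_into_cancel[OF assms(1)] bij_betw_inv_into[OF assms(1)]
  by (intro inv_into_f_eq) (auto simp: bij_betw_def)

context diffeological_space begin

lemma smooth_map_restrict:
  "smooth_map A B f \<Longrightarrow> smooth_map A B (restrict f (points A))"
  by (rule smooth_map_cong) auto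

text \<open>Membership asks for smoothness of a map and of its inverse. Inversion swaps the two
  demands, and a composite is inverted by composing the inverses in the opposite order.\<close>

lemma subgroup_Diff: "subgroup (carrier (Diff A)) (BijGroup (points A))"
proof
  show "carrier (Diff A) \<subseteq> carrier (BijGroup (points A))"
    by (auto simp: mem_Diff BijGroup_def)
  show "\<one>\<^bsub>BijGroup (points A)\<^esub> \<in> carrier (Diff A)"
  proof -
    have "smooth_map A A (inv_into (points A) (\<lambda>x\<in>points A. x))"
      by (rule smooth_map_cong[OF smooth_map_id])
        (rule inv_into_f_eq[symmetric], auto simp: inj_on_def)
    then show ?thesis
      by (simp add: BijGroup_def mem_Diff id_Bij smooth_map_restrict smooth_map_id)
  qed
  fix f assume f: "f \<in> carrier (Diff A)"
  have "smooth_map A A (inv_into (points A) (\<lambda>x\<in>points A. inv_into (points A) f x))"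
    by (rule smooth_map_cong[of _ f]) (use f in \<open>auto simp: mem_Diff inv_into_inv_eq[OF Diff_bij]\<close>)
  with f show "inv\<^bsub>BijGroup (points A)\<^esub> f \<in> carrier (Diff A)"
    by (simp add: mem_Diff inv_BijGroup restrict_inv_into_Bij smooth_map_restrict)
  fix g assume g: "g \<in> carrier (Diff A)"
  have "smooth_map A A (compose (points A) f g)"
    unfolding compose_def
    by (rule smooth_map_restrict, rule smooth_map_comp[of A A g A f])
      (use f g in \<open>simp_all add: mem_Diff\<close>)
  moreover have "smooth_map A A (inv_into (points A) (compose (points A) f g))"
  proof (rule smooth_map_cong)
    show "smooth_map A A (\<lambda>x. inv_into (points A) g (inv_into (points A) f x))"
      by (rule smooth_map_comp[of A A _ A]) (use f g in \<open>simp_all add: mem_Diff\<close>)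
  qed (simp add: inv_into_compose_eq f g Diff_bij)
  ultimately show "f \<otimes>\<^bsub>BijGroup (points A)\<^esub> g \<in> carrier (Diff A)"
    using f g by (simp add: BijGroup_def mem_Diff compose_Bij)
qed

text \<open>The shape in which general facts on subgroups yield the group structure and the inverses
  of \<open>Diff A\<close>.\<close>

lemma Diff_eq: "Diff A = (BijGroup (points A))\<lparr>carrier := carrier (Diff A)\<rparr>"
  by (simp add: Diff_def)

lemma group_Diff: "group (Diff A)"
  by (subst Diff_eq) (rule group.subgroup_imp_group[OF group_BijGroup subgroup_Diff])

lemma inv_Diff:
  "f \<in> carrier (Diff A) \<Longrightarrow> inv\<^bsub>Diff A\<^esub> f = (\<lambda>x\<in>points A. inv_into (points A) f x)"
  by (subst Diff_eq)
    (simp add: group.m_inv_consistent[OF group_BijGroup subgroup_Diff] inv_BijGroup mem_Diff)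

end

subsection \<open>Smooth families of maps\<close>

text \<open>One half of the plot condition of \<open>Diff_space\<close>. Arbitrary families of maps
  are allowed, so that it applies equally to a family of diffeomorphisms, to its pointwise
  \<open>inv_into\<close> and to unnormalised composites.\<close>

definition smooth_family ::
  "'a dspace \<Rightarrow> nat \<Rightarrow> (nat \<Rightarrow> real) set \<Rightarrow> ((nat \<Rightarrow> real) \<Rightarrow> 'a \<Rightarrow> 'a) \<Rightarrow> bool"
where
  "smooth_family A n U \<sigma> \<longleftrightarrow> (\<forall>(m, V, p) \<in> plots A.
     (m + n, euclid_times m V n U,
        \<lambda>w \<in> euclid_times m V n U. \<sigma> (hi_part m w) (p (lo_part m w))) \<in> plots A)"

lemma smooth_familyD:
  "smooth_family A n U \<sigma> \<Longrightarrow> (m, V, p) \<in> plots A \<Longrightarrow>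
   (m + n, euclid_times m V n U,
      \<lambda>w \<in> euclid_times m V n U. \<sigma> (hi_part m w) (p (lo_part m w))) \<in> plots A"
  by (auto simp: smooth_family_def)

lemma plots_Diff_space:
  "(n, U, \<rho>) \<in> plots (Diff_space A) \<longleftrightarrow>
     openin (Euclidean_space n) U \<and> \<rho> \<in> U \<rightarrow>\<^sub>E carrier (Diff A) \<and>
     smooth_family A n U \<rho> \<and> smooth_family A n U (\<lambda>u. inv_into (points A) (\<rho> u))"
  by (auto simp: Diff_space_def smooth_family_def)

lemma points_Diff_space [simp]: "points (Diff_space A) = carrier (Diff A)"
  by (simp add: Diff_space_def)

context diffeological_space begin

lemma smooth_family_cong:
  assumes "smooth_family A n U \<sigma>" "\<And>u a. u \<in> U \<Longrightarrow> a \<in> points A \<Longrightarrow> \<sigma> u a = \<tau> u a"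
  shows "smooth_family A n U \<tau>"
  unfolding smooth_family_def
proof clarify
  fix m V p assume p: "(m, V, p) \<in> plots A"
  have "(\<lambda>w \<in> euclid_times m V n U. \<tau> (hi_part m w) (p (lo_part m w))) =
      (\<lambda>w \<in> euclid_times m V n U. \<sigma> (hi_part m w) (p (lo_part m w)))"
    by (rule restrict_ext) (use assms(2) plots_param[OF p] in \<open>auto simp: euclid_times_def PiE_def Pi_def\<close>)
  with smooth_familyD[OF assms(1) p]
  show "(m + n, euclid_times m V n U,
      \<lambda>w \<in> euclid_times m V n U. \<tau> (hi_part m w) (p (lo_part m w))) \<in> plots A"
    by simp
qed

lemma smooth_family_const:
  assumes U: "openin (Euclidean_space n) U" and f: "smooth_map A A f"
  shows "smooth_family A n U (\<lambda>_. f)"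
  unfolding smooth_family_def
proof clarify
  fix m V p assume p: "(m, V, p) \<in> plots A"
  then have "(m, V, compose V f p) \<in> plots A"
    using f by (auto simp: smooth_map_def)
  moreover have "openin (Euclidean_space m) V"
    using plots_param[OF p] by simp
  ultimately show "(m + n, euclid_times m V n U,
      \<lambda>w \<in> euclid_times m V n U. f (p (lo_part m w))) \<in> plots A"
    by (rule plots_reparam'[OF _ openin_euclid_times[OF _ U] smooth_lo_part])
      (auto simp: compose_def euclid_times_def)
qed

text \<open>The product domain is covered by the open sets \<open>euclid_times m V n W\<close>: only
  the parameter domain shrinks, while the test plot keeps its domain \<open>V\<close>.\<close>

lemma smooth_family_local:
  assumes U: "openin (Euclidean_space n) U"
    and loc: "\<And>r. r \<in> U \<Longrightarrow> \<exists>W. openin (Euclidean_space n) W \<and> r \<in> W \<and> W \<subseteq> U \<and> smooth_family A n W \<sigma>"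
  shows "smooth_family A n U \<sigma>"
  unfolding smooth_family_def
proof clarify
  fix m V p assume p: "(m, V, p) \<in> plots A"
  then have V: "openin (Euclidean_space m) V"
    using plots_param[OF p] by simp
  show "(m + n, euclid_times m V n U,
      \<lambda>w \<in> euclid_times m V n U. \<sigma> (hi_part m w) (p (lo_part m w))) \<in> plots A"
  proof (rule plots_glue[OF openin_euclid_times[OF V U]])
    fix w assume w: "w \<in> euclid_times m V n U"
    then have "hi_part m w \<in> U"
      by (simp add: euclid_times_def)
    then obtain W where W: "openin (Euclidean_space n) W" "hi_part m w \<in> W" "W \<subseteq> U"
      "smooth_family A n W \<sigma>"
      using loc by blast
    moreover have sub: "euclid_times m V n W \<subseteq> euclid_times m V n U"
      using W(3) by (simp add: euclid_times_mono)
    moreover have "w \<in> euclid_times m V n W"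
      using w W(2) by (simp add: euclid_times_def)
    moreover note openin_euclid_times[OF V W(1)] smooth_familyD[OF W(4) p]
    ultimately show "\<exists>T q. openin (Euclidean_space (m + n)) T \<and> w \<in> T \<and> T \<subseteq> euclid_times m V n U \<and>
        (m + n, T, q) \<in> plots A \<and>
        (\<forall>x\<in>T. (\<lambda>w \<in> euclid_times m V n U. \<sigma> (hi_part m w) (p (lo_part m w))) x = q x)"
      by (intro exI[of _ "euclid_times m V n W"] exI conjI) auto
  qed auto
qed

text \<open>The new evaluation map is that of \<open>\<sigma>\<close> precomposed with
  \<open>times_right m F\<close>.\<close>

lemma smooth_family_reparam:
  assumes U: "openin (Euclidean_space n) U" and W: "openin (Euclidean_space l) W"
    and F: "smooth_euclidean l W n U F" and \<sigma>: "smooth_family A n U \<sigma>"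
  shows "smooth_family A l W (\<lambda>u. \<sigma> (F u))"
  unfolding smooth_family_def
proof clarify
  fix m V p assume p: "(m, V, p) \<in> plots A"
  then have V: "openin (Euclidean_space m) V"
    using plots_param[OF p] by simp
  have "times_right m F \<in> euclid_times m V l W \<rightarrow> euclid_times m V n U"
    using smooth_times_right[OF U F] by (simp add: smooth_euclidean_def)
  then show "(m + l, euclid_times m V l W,
      \<lambda>w \<in> euclid_times m V l W. \<sigma> (F (hi_part m w)) (p (lo_part m w))) \<in> plots A"
    by (intro plots_reparam'[OF smooth_familyD[OF \<sigma> p] openin_euclid_times[OF V W]
          smooth_times_right[OF U F]])
      (auto simp: Pi_iff)
qed

lemma smooth_family_compose:
  assumes U: "openin (Euclidean_space n) U"
    and \<sigma>: "smooth_family A n U \<sigma>" and \<tau>: "smooth_family A n U \<tau>"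
  shows "smooth_family A n U (\<lambda>u a. \<sigma> u (\<tau> u a))"
  unfolding smooth_family_def
proof clarify
  fix m V p assume p: "(m, V, p) \<in> plots A"
  then have V: "openin (Euclidean_space m) V"
    using plots_param[OF p] by simp
  have "dup_hi m n \<in> euclid_times m V n U \<rightarrow> euclid_times (m + n) (euclid_times m V n U) n U"
    using smooth_dup_hi by (simp add: smooth_euclidean_def)
  \<comment> \<open>\<open>lo_part_dup_hi\<close> is available only for points of the Euclidean
    space.\<close>
  moreover have "euclid_times m V n U \<subseteq> topspace (Euclidean_space (m + n))"
    by (auto simp: euclid_times_def)
  ultimately show "(m + n, euclid_times m V n U,
      \<lambda>w \<in> euclid_times m V n U. \<sigma> (hi_part m w) (\<tau> (hi_part m w) (p (lo_part m w)))) \<in> plots A"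
    by (intro plots_reparam'[OF smooth_familyD[OF \<sigma> smooth_familyD[OF \<tau> p]]
          openin_euclid_times[OF V U] smooth_dup_hi])
      (auto simp: Pi_iff lo_part_dup_hi hi_part_dup_hi subset_iff)
qed

lemma diffeological_Diff_space: "diffeological_space (Diff_space A)"
proof
  show "openin (Euclidean_space n) U \<and> \<rho> \<in> U \<rightarrow>\<^sub>E points (Diff_space A)"
    if "(n, U, \<rho>) \<in> plots (Diff_space A)" for n U \<rho>
    using that by (simp add: plots_Diff_space)
next
  fix n U f assume U: "openin (Euclidean_space n) U" and f: "f \<in> points (Diff_space A)"
  then have "smooth_family A n U (\<lambda>_. f)" "smooth_family A n U (\<lambda>_. inv_into (points A) f)"
    by (auto intro!: smooth_family_const simp: mem_Diff)
  then have "smooth_family A n U (\<lambda>u\<in>U. f)"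
      "smooth_family A n U (\<lambda>u. inv_into (points A) ((\<lambda>u\<in>U. f) u))"
    by - (rule smooth_family_cong, assumption, simp)+
  with U f show "(n, U, \<lambda>r\<in>U. f) \<in> plots (Diff_space A)"
    by (auto simp: plots_Diff_space)
next
  fix n U \<rho>
  assume U: "openin (Euclidean_space n) U" and \<rho>: "\<rho> \<in> U \<rightarrow>\<^sub>E points (Diff_space A)"
    and loc: "\<And>r. r \<in> U \<Longrightarrow> \<exists>V. openin (Euclidean_space n) V \<and> r \<in> V \<and> V \<subseteq> U \<and>
                          (n, V, restrict \<rho> V) \<in> plots (Diff_space A)"
  \<comment> \<open>The hypothesis gives one \<open>V\<close> serving both conditions, but for
    \<open>restrict \<rho> V\<close>; congruence of families on \<open>V\<close> removes the
    restriction.\<close>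
  have "\<exists>V. openin (Euclidean_space n) V \<and> r \<in> V \<and> V \<subseteq> U \<and>
      smooth_family A n V \<rho> \<and> smooth_family A n V (\<lambda>u. inv_into (points A) (\<rho> u))" if "r \<in> U" for r
  proof -
    obtain V where V: "openin (Euclidean_space n) V" "r \<in> V" "V \<subseteq> U"
      "smooth_family A n V (restrict \<rho> V)"
      "smooth_family A n V (\<lambda>u. inv_into (points A) (restrict \<rho> V u))"
      using loc[OF \<open>r \<in> U\<close>] by (auto simp: plots_Diff_space)
    have "smooth_family A n V \<rho>" "smooth_family A n V (\<lambda>u. inv_into (points A) (\<rho> u))"
      by (rule smooth_family_cong[OF V(4)], simp, rule smooth_family_cong[OF V(5)], simp)
    with V show ?thesis by blast
  qed
  then have "smooth_family A n U \<rho>" "smooth_family A n U (\<lambda>u. inv_into (points A) (\<rho> u))"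
    by - (rule smooth_family_local[OF U], blast)+
  with U \<rho> show "(n, U, \<rho>) \<in> plots (Diff_space A)"
    by (simp add: plots_Diff_space)
next
  fix n U \<rho> m V F
  assume "(n, U, \<rho>) \<in> plots (Diff_space A)" and V: "openin (Euclidean_space m) V"
    and F: "smooth_euclidean m V n U F"
  then have U: "openin (Euclidean_space n) U" and \<rho>: "\<rho> \<in> U \<rightarrow>\<^sub>E carrier (Diff A)"
    and fam: "smooth_family A n U \<rho>" "smooth_family A n U (\<lambda>u. inv_into (points A) (\<rho> u))"
    by (auto simp: plots_Diff_space)
  have "smooth_family A m V (compose V \<rho> F)"
    by (rule smooth_family_cong[OF smooth_family_reparam[OF U V F fam(1)]]) (simp add: compose_eq)
  moreover have "smooth_family A m V (\<lambda>u. inv_into (points A) (compose V \<rho> F u))"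
    by (rule smooth_family_cong[OF smooth_family_reparam[OF U V F fam(2)]]) (simp add: compose_eq)
  moreover have "compose V \<rho> F \<in> V \<rightarrow>\<^sub>E carrier (Diff A)"
    using \<rho> F by (auto simp: smooth_euclidean_def compose_def)
  ultimately show "(m, V, compose V \<rho> F) \<in> plots (Diff_space A)"
    using V by (simp add: plots_Diff_space)
qed

text \<open>Multiplication composes two families pointwise and their inverse families in the
  opposite order; inversion exchanges the two halves of the plot condition.\<close>

theorem diffeological_group_Diff: "diffeological_group (Diff A) (Diff_space A)"
  unfolding diffeological_group_def
proof (intro conjI group_Diff diffeological_Diff_space points_Diff_space)
  interpret G: group "Diff A" by (rule group_Diff)
  have "(n, U, compose U (\<lambda>(x, y). x \<otimes>\<^bsub>Diff A\<^esub> y) p) \<in> plots (Diff_space A)"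
    if "(n, U, p) \<in> plots (prod_space (Diff_space A) (Diff_space A))" for n U p
  proof -
    define \<rho> \<sigma> where "\<rho> = compose U fst p" and "\<sigma> = compose U snd p"
    have U: "openin (Euclidean_space n) U"
      and \<rho>: "\<rho> \<in> U \<rightarrow>\<^sub>E carrier (Diff A)" "smooth_family A n U \<rho>"
        "smooth_family A n U (\<lambda>u. inv_into (points A) (\<rho> u))"
      and \<sigma>: "\<sigma> \<in> U \<rightarrow>\<^sub>E carrier (Diff A)" "smooth_family A n U \<sigma>"
        "smooth_family A n U (\<lambda>u. inv_into (points A) (\<sigma> u))"
      using that by (auto simp: prod_space_def plots_Diff_space \<rho>_def \<sigma>_def)
    have D: "\<rho> u \<in> carrier (Diff A)" "\<sigma> u \<in> carrier (Diff A)" if "u \<in> U" for u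
      using that \<rho>(1) \<sigma>(1) by auto
    define q where "q = compose U (\<lambda>(x, y). x \<otimes>\<^bsub>Diff A\<^esub> y) p"
    have q: "q u = compose (points A) (\<rho> u) (\<sigma> u)" if "u \<in> U" for u
      using D[OF that] that
      by (simp add: q_def \<rho>_def \<sigma>_def compose_eq mult_Diff split_beta)
    have "smooth_family A n U q"
      by (rule smooth_family_cong[OF smooth_family_compose[OF U \<rho>(2) \<sigma>(2)]])
        (simp add: q compose_eq)
    moreover have "smooth_family A n U (\<lambda>u. inv_into (points A) (q u))"
      by (rule smooth_family_cong[OF smooth_family_compose[OF U \<sigma>(3) \<rho>(3)]])
        (simp add: q inv_into_compose_eq D Diff_bij)
    moreover have "q \<in> U \<rightarrow>\<^sub>E carrier (Diff A)"
    proof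
      show "q u \<in> carrier (Diff A)" if "u \<in> U" for u
        using G.m_closed[OF D[OF that]] that by (simp add: q mult_Diff D)
    qed (simp add: q_def compose_def)
    ultimately show ?thesis
      using U by (simp add: plots_Diff_space q_def)
  qed
  then show "smooth_map (prod_space (Diff_space A) (Diff_space A)) (Diff_space A)
      (\<lambda>(x, y). x \<otimes>\<^bsub>Diff A\<^esub> y)"
    by (auto simp: smooth_map_def) (simp add: prod_space_def)
  have "(n, U, compose U (\<lambda>x. inv\<^bsub>Diff A\<^esub> x) \<rho>) \<in> plots (Diff_space A)"
    if "(n, U, \<rho>) \<in> plots (Diff_space A)" for n U \<rho>
  proof -
    have U: "openin (Euclidean_space n) U"
      and \<rho>: "\<rho> \<in> U \<rightarrow>\<^sub>E carrier (Diff A)" "smooth_family A n U \<rho>"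
        "smooth_family A n U (\<lambda>u. inv_into (points A) (\<rho> u))"
      using that by (auto simp: plots_Diff_space)
    have D: "\<rho> u \<in> carrier (Diff A)" if "u \<in> U" for u
      using PiE_mem[OF \<rho>(1) that] .
    define q where "q = compose U (\<lambda>x. inv\<^bsub>Diff A\<^esub> x) \<rho>"
    have q: "q u = (\<lambda>x\<in>points A. inv_into (points A) (\<rho> u) x)" if "u \<in> U" for u
      using that inv_Diff[OF D] by (simp add: q_def compose_eq)
    have "smooth_family A n U q"
      by (rule smooth_family_cong[OF \<rho>(3)]) (simp add: q)
    moreover have "smooth_family A n U (\<lambda>u. inv_into (points A) (q u))"
      by (rule smooth_family_cong[OF \<rho>(2)]) (simp add: q inv_into_inv_eq[OF Diff_bij[OF D]])
    moreover have "q \<in> U \<rightarrow>\<^sub>E carrier (Diff A)"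
      using G.inv_closed[OF D] by (auto simp: q_def compose_def)
    ultimately show ?thesis
      using U by (simp add: plots_Diff_space q_def)
  qed
  then show "smooth_map (Diff_space A) (Diff_space A) (\<lambda>x. inv\<^bsub>Diff A\<^esub> x)"
    by (auto simp: smooth_map_def)
qed

end

section \<open>Subductions\<close>

text \<open>Minimality of the push-forward: the parametrisations of \<open>B\<close> that lift
  locally along \<open>f\<close> form a diffeology containing every \<open>compose U f p\<close>,
  hence they include all plots of \<open>B\<close>.\<close>

lemma subduction_lift:
  assumes "diffeological_space A" and sub: "subduction A B f"
    and surj: "f ` points A = points B"
    and p: "(n, U, p) \<in> plots B" and r: "r \<in> U"
  obtains V q where "openin (Euclidean_space n) V" "r \<in> V" "V \<subseteq> U" "(n, V, q) \<in> plots A"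
    "\<And>x. x \<in> V \<Longrightarrow> f (q x) = p x"
proof -
  interpret A: diffeological_space A by fact
  define lifts where "lifts n U p r \<longleftrightarrow> (\<exists>V q. openin (Euclidean_space n) V \<and> r \<in> V \<and> V \<subseteq> U \<and>
      (n, V, q) \<in> plots A \<and> (\<forall>x\<in>V. f (q x) = p x))" for n U p r
  define D where "D = {(n, U, p). openin (Euclidean_space n) U \<and> p \<in> U \<rightarrow>\<^sub>E points B \<and>
      (\<forall>r\<in>U. lifts n U p r)}"
  have "diffeological_space \<lparr>points = points B, plots = D\<rparr>"
  proof
    show "openin (Euclidean_space n) U \<and> p \<in> U \<rightarrow>\<^sub>E points \<lparr>points = points B, plots = D\<rparr>"
      if "(n, U, p) \<in> plots \<lparr>points = points B, plots = D\<rparr>" for n U p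
      using that by (simp add: D_def)
  next
    fix n U b
    assume U: "openin (Euclidean_space n) U" and b: "b \<in> points \<lparr>points = points B, plots = D\<rparr>"
    \<comment> \<open>Constants lift because \<open>f\<close> is onto.\<close>
    then obtain a where a: "a \<in> points A" "b = f a"
      using surj by auto
    have "lifts n U (\<lambda>r\<in>U. b) r" if "r \<in> U" for r
      unfolding lifts_def using A.plots_const[OF U a(1)] U that a(2)
      by (intro exI[of _ U] exI[of _ "\<lambda>r\<in>U. a"]) simp
    with U b show "(n, U, \<lambda>r\<in>U. b) \<in> plots \<lparr>points = points B, plots = D\<rparr>"
      by (simp add: D_def)
  next
    fix n U p
    assume U: "openin (Euclidean_space n) U" and p: "p \<in> U \<rightarrow>\<^sub>E points \<lparr>points = points B, plots = D\<rparr>"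
      and loc: "\<And>r. r \<in> U \<Longrightarrow> \<exists>V. openin (Euclidean_space n) V \<and> r \<in> V \<and> V \<subseteq> U \<and>
        (n, V, restrict p V) \<in> plots \<lparr>points = points B, plots = D\<rparr>"
    have "lifts n U p r" if r: "r \<in> U" for r
    proof -
      \<comment> \<open>Lifting at \<open>r\<close> only concerns small neighbourhoods, so a lift of
        the restriction to \<open>W\<close> also serves on \<open>U\<close>.\<close>
      obtain W where W: "r \<in> W" "W \<subseteq> U" "lifts n W (restrict p W) r"
        using loc[OF r] by (auto simp: D_def)
      then obtain V q where "openin (Euclidean_space n) V" "r \<in> V" "V \<subseteq> W"
        "(n, V, q) \<in> plots A" "\<forall>x\<in>V. f (q x) = restrict p W x"
        unfolding lifts_def by blast
      with W(2) show ?thesis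
        unfolding lifts_def by (intro exI[of _ V] exI[of _ q]) auto
    qed
    with U p show "(n, U, p) \<in> plots \<lparr>points = points B, plots = D\<rparr>"
      by (simp add: D_def)
  next
    fix n U p m V F
    assume "(n, U, p) \<in> plots \<lparr>points = points B, plots = D\<rparr>"
      and V: "openin (Euclidean_space m) V" and F: "smooth_euclidean m V n U F"
    then have U: "openin (Euclidean_space n) U" and p: "p \<in> U \<rightarrow>\<^sub>E points B"
      and lift: "\<And>r. r \<in> U \<Longrightarrow> lifts n U p r"
      by (auto simp: D_def)
    have FVU: "F \<in> V \<rightarrow> U"
      using F by (simp add: smooth_euclidean_def)
    have "lifts m V (compose V p F) r" if r: "r \<in> V" for r
    proof -
      obtain W q where W: "openin (Euclidean_space n) W" "F r \<in> W" "W \<subseteq> U"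
        "(n, W, q) \<in> plots A" "\<forall>x\<in>W. f (q x) = p x"
        using lift[of "F r"] FVU r unfolding lifts_def by blast
      \<comment> \<open>The lift \<open>q\<close> is defined on \<open>W\<close> only, so the
        composite with \<open>F\<close> is formed on the preimage of \<open>W\<close>.\<close>
      define V' where "V' = {x \<in> V. F x \<in> W}"
      have V': "openin (Euclidean_space m) V'"
        unfolding V'_def by (rule smooth_euclidean_preimage[OF V U F W(1)])
      have "smooth_euclidean m V' n W F"
        by (rule smooth_euclidean_subset[OF F]) (auto simp: V'_def)
      from A.plots_reparam[OF W(4) V' this] show ?thesis
        unfolding lifts_def using V' r W(2,5)
        by (intro exI[of _ V'] exI[of _ "compose V' q F"]) (auto simp: V'_def compose_def)
    qed
    moreover have "compose V p F \<in> V \<rightarrow>\<^sub>E points B"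
      using p FVU by (auto simp: compose_def)
    ultimately show "(m, V, compose V p F) \<in> plots \<lparr>points = points B, plots = D\<rparr>"
      using V by (simp add: D_def)
  qed
  moreover have "(n, U, compose U f p) \<in> D" if p: "(n, U, p) \<in> plots A" for n U p
  proof -
    have "openin (Euclidean_space n) U" "p \<in> U \<rightarrow>\<^sub>E points A"
      using A.plots_param[OF p] by auto
    moreover have "lifts n U (compose U f p) r" if "r \<in> U" for r
      unfolding lifts_def using calculation p that
      by (intro exI[of _ U] exI[of _ p]) (simp add: compose_eq)
    ultimately show ?thesis
      using surj by (auto simp: D_def compose_def)
  qed
  ultimately have "pushforward f A (points B) \<subseteq> D"
    unfolding pushforward_def by blast
  with p sub have "(n, U, p) \<in> D"
    by (auto simp: subduction_def)
  with r have "lifts n U p r"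
    by (simp add: D_def)
  then show thesis
    unfolding lifts_def using that by blast
qed

text \<open>Stated for any family \<open>\<tau>\<close> intertwined with \<open>\<sigma>\<close> by
  \<open>f\<close>, so that it serves both for the induced base maps and for their inverses.\<close>

lemma smooth_family_subduction:
  assumes A: "diffeological_space A" and B: "diffeological_space B"
    and f: "smooth_map A B f" "subduction A B f" "f ` points A = points B"
    and U: "openin (Euclidean_space n) U" and \<sigma>: "smooth_family A n U \<sigma>"
    and eq: "\<And>u a. u \<in> U \<Longrightarrow> a \<in> points A \<Longrightarrow> f (\<sigma> u a) = \<tau> u (f a)"
  shows "smooth_family B n U \<tau>"
  unfolding smooth_family_def
proof clarify
  interpret A: diffeological_space A by fact
  interpret B: diffeological_space B by fact
  fix m V p assume p: "(m, V, p) \<in> plots B"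
  then have V: "openin (Euclidean_space m) V"
    using B.plots_param[OF p] by simp
  show "(m + n, euclid_times m V n U,
      \<lambda>w \<in> euclid_times m V n U. \<tau> (hi_part m w) (p (lo_part m w))) \<in> plots B"
  proof (rule B.plots_glue[OF openin_euclid_times[OF V U]])
    fix w assume w: "w \<in> euclid_times m V n U"
    then have "lo_part m w \<in> V"
      by (simp add: euclid_times_def)
    then obtain W q where W: "openin (Euclidean_space m) W" "lo_part m w \<in> W" "W \<subseteq> V"
        "(m, W, q) \<in> plots A" and fq: "\<And>x. x \<in> W \<Longrightarrow> f (q x) = p x"
      by (rule subduction_lift[OF A f(2,3) p]) blast
    \<comment> \<open>Lifting shrinks the domain of the test plot only; the parameters still range
      over \<open>U\<close>.\<close>
    define T where "T = euclid_times m W n U"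
    define s where "s = (\<lambda>w\<in>T. \<sigma> (hi_part m w) (q (lo_part m w)))"
    have "(m + n, T, s) \<in> plots A"
      unfolding T_def s_def by (rule smooth_familyD[OF \<sigma> W(4)])
    from smooth_mapD(2)[OF f(1) this] have "(m + n, T, compose T f s) \<in> plots B" .
    moreover have "openin (Euclidean_space (m + n)) T"
      unfolding T_def by (rule openin_euclid_times[OF W(1) U])
    moreover have "w \<in> T"
      using w W(2) by (simp add: T_def euclid_times_def)
    moreover have TV: "T \<subseteq> euclid_times m V n U"
      unfolding T_def using W(3) by (simp add: euclid_times_mono)
    moreover have "compose T f s x = \<tau> (hi_part m x) (p (lo_part m x))" if x: "x \<in> T" for x
    proof -
      have "lo_part m x \<in> W" "hi_part m x \<in> U"
        using x by (simp_all add: T_def euclid_times_def)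
      moreover from this have "q (lo_part m x) \<in> points A"
        using A.plots_param[OF W(4)] by auto
      ultimately show ?thesis
        using x by (simp add: compose_eq s_def eq fq)
    qed
    ultimately show "\<exists>T s. openin (Euclidean_space (m + n)) T \<and> w \<in> T \<and> T \<subseteq> euclid_times m V n U \<and>
        (m + n, T, s) \<in> plots B \<and>
        (\<forall>x\<in>T. (\<lambda>w \<in> euclid_times m V n U. \<tau> (hi_part m w) (p (lo_part m w))) x = s x)"
      by (intro exI[of _ T] exI[of _ "compose T f s"]) auto
  qed simp
qed

section \<open>Bundle morphisms\<close>

text \<open>Linearity of \<open>g\<close> involves its values at sums and scalar multiples; the
  module axioms keep these in the carrier, where \<open>f\<close> and \<open>g\<close>
  agree.\<close>

lemma linear_map_cong:
  assumes "Module.module K M" "linear_map K M N f" "\<And>u. u \<in> carrier M \<Longrightarrow> f u = g u"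
  shows "linear_map K M N g"
proof -
  interpret Module.module K M by fact
  have "f u \<in> carrier N" if "u \<in> carrier M" for u
    using assms(2) that by (auto simp: linear_map_def)
  with assms(2) show ?thesis
    by (simp add: linear_map_def assms(3)[symmetric] Pi_iff)
qed

lemma linear_map_comp:
  "linear_map K L M f \<Longrightarrow> linear_map K M N g \<Longrightarrow> linear_map K L N (\<lambda>u. g (f u))"
  by (auto simp: linear_map_def Pi_iff)

lemma bundle_morphismD:
  assumes "bundle_morphism K B C \<phi> f"
  shows "smooth_map (total B) (total C) \<phi>" "smooth_map (base B) (base C) f"
    and "u \<in> points (total B) \<Longrightarrow> proj C (\<phi> u) = f (proj B u)"
    and "x \<in> points (base B) \<Longrightarrow> linear_map K (fiber_module B x) (fiber_module C (f x)) \<phi>"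
  using assms by (simp_all add: bundle_morphism_def)

lemma bundle_morphism_comp:
  assumes \<phi>: "bundle_morphism K B C \<phi> f" and \<psi>: "bundle_morphism K C D \<psi> g"
  shows "bundle_morphism K B D (\<lambda>u. \<psi> (\<phi> u)) (\<lambda>x. g (f x))"
proof -
  note \<phi> = bundle_morphismD[OF \<phi>] and \<psi> = bundle_morphismD[OF \<psi>]
  have "\<phi> u \<in> points (total C)" if "u \<in> points (total B)" for u
    using smooth_mapD(1)[OF \<phi>(1)] that by auto
  moreover have "f x \<in> points (base C)" if "x \<in> points (base B)" for x
    using smooth_mapD(1)[OF \<phi>(2)] that by auto
  ultimately show ?thesis
    unfolding bundle_morphism_def
    using smooth_map_comp[OF \<phi>(1) \<psi>(1)] smooth_map_comp[OF \<phi>(2) \<psi>(2)]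
    by (auto simp: \<phi>(3) \<psi>(3) intro: linear_map_comp[OF \<phi>(4) \<psi>(4)])
qed

text \<open>The inverse of an automorphism is given as some two-sided smooth inverse; the second
  conclusion identifies it on the carrier with the canonical \<open>inv_into\<close>.\<close>

lemma (in diffeological_space) mem_DiffI:
  assumes f: "f \<in> extensional (points A)" "smooth_map A A f" and g: "smooth_map A A g"
    and gf: "\<And>x. x \<in> points A \<Longrightarrow> g (f x) = x" and fg: "\<And>x. x \<in> points A \<Longrightarrow> f (g x) = x"
  shows "f \<in> carrier (Diff A)" and "x \<in> points A \<Longrightarrow> inv_into (points A) f x = g x"
proof -
  have gA: "g x \<in> points A" if "x \<in> points A" for x
    using smooth_mapD(1)[OF g] that by auto
  have bij: "bij_betw f (points A) (points A)"
    by (rule bij_betw_byWitness[of _ g]) (use gf fg smooth_mapD(1)[OF f(2)] gA in auto)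
  have inv: "inv_into (points A) f x = g x" if "x \<in> points A" for x
    using inv_into_cancel(3)[OF bij gA[OF that]] fg[OF that] by simp
  then show "x \<in> points A \<Longrightarrow> inv_into (points A) f x = g x" .
  have "smooth_map A A (inv_into (points A) f)"
    by (rule smooth_map_cong[OF g]) (simp add: inv)
  with f bij show "f \<in> carrier (Diff A)"
    by (simp add: mem_Diff Bij_def)
qed

section \<open>The automorphism group of a pseudo-bundle\<close>

context vector_pseudo_bundle begin

interpretation total: diffeological_space "total B"
  using vector_pseudo_bundle_axioms by (simp add: vector_pseudo_bundle_def)

interpretation base: diffeological_space "base B"
  using vector_pseudo_bundle_axioms by (simp add: vector_pseudo_bundle_def)

interpretation DT: group "Diff (total B)"
  by (rule total.group_Diff)

interpretation DB: group "Diff (base B)"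
  by (rule base.group_Diff)

lemma smooth_proj: "smooth_map (total B) (base B) (proj B)"
  and proj_onto: "proj B ` points (total B) = points (base B)"
  and subduction_proj: "subduction (total B) (base B) (proj B)"
  using vector_pseudo_bundle_axioms by (simp_all add: vector_pseudo_bundle_def)

lemma module_fiber: "x \<in> points (base B) \<Longrightarrow> Module.module K (fiber_module B x)"
  using vector_pseudo_bundle_axioms
  by (simp add: vector_pseudo_bundle_def diffeological_vector_space_def)

text \<open>Products and inverses in \<open>Diff\<close> are extensional, while composites of
  morphisms and the given inverse morphisms need not be; this passes from one to the other.\<close>

lemma bundle_morphism_cong:
  assumes \<phi>: "bundle_morphism K B C \<phi> f"
    and eq: "\<And>u. u \<in> points (total B) \<Longrightarrow> \<phi> u = \<psi> u" "\<And>x. x \<in> points (base B) \<Longrightarrow> f x = g x"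
  shows "bundle_morphism K B C \<psi> g"
proof -
  note \<phi> = bundle_morphismD[OF \<phi>]
  have "linear_map K (fiber_module B x) (fiber_module C (g x)) \<psi>" if x: "x \<in> points (base B)" for x
    by (rule linear_map_cong[OF module_fiber[OF x], of _ \<phi>])
      (use \<phi>(4)[OF x] x in \<open>auto simp: eq fiber_module_def fiber_def\<close>)
  moreover have "proj C (\<psi> u) = g (proj B u)" if u: "u \<in> points (total B)" for u
    using \<phi>(3)[OF u] u proj_onto eq by auto
  ultimately show ?thesis
    using total.smooth_map_cong[OF \<phi>(1) eq(1)] base.smooth_map_cong[OF \<phi>(2) eq(2)]
    by (simp add: bundle_morphism_def)
qed

lemma bundle_morphism_id: "bundle_morphism K B B (\<lambda>u. u) (\<lambda>x. x)"
  by (simp add: bundle_morphism_def total.smooth_map_id base.smooth_map_id linear_map_def)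

section \<open>Automorphism pairs inside the two diffeomorphism groups\<close>

lemma Aut_pairsE:
  assumes "(\<phi>, f) \<in> Aut_pairs K B"
  obtains \<psi> g where "bundle_morphism K B B \<phi> f" "bundle_morphism K B B \<psi> g"
    "\<And>u. u \<in> points (total B) \<Longrightarrow> \<psi> (\<phi> u) = u" "\<And>u. u \<in> points (total B) \<Longrightarrow> \<phi> (\<psi> u) = u"
    "\<And>x. x \<in> points (base B) \<Longrightarrow> g (f x) = x" "\<And>x. x \<in> points (base B) \<Longrightarrow> f (g x) = x"
    "\<phi> \<in> extensional (points (total B))" "f \<in> extensional (points (base B))"
  using assms unfolding Aut_pairs_def by blast

text \<open>Replaces the existentially quantified inverse morphism by the group inverses of both
  components. Together with the converse \<open>Aut_pairsI\<close> it reduces closure of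
  \<open>Aut_pairs\<close> to algebra in the groups \<open>Diff\<close>.\<close>

lemma Aut_pairs_Diff:
  assumes "(\<phi>, f) \<in> Aut_pairs K B"
  shows "\<phi> \<in> carrier (Diff (total B))" and "f \<in> carrier (Diff (base B))"
    and "bundle_morphism K B B \<phi> f"
    and "bundle_morphism K B B (inv\<^bsub>Diff (total B)\<^esub> \<phi>) (inv\<^bsub>Diff (base B)\<^esub> f)"
proof -
  obtain \<psi> g where \<phi>: "bundle_morphism K B B \<phi> f" and \<psi>: "bundle_morphism K B B \<psi> g"
    and inv: "\<And>u. u \<in> points (total B) \<Longrightarrow> \<psi> (\<phi> u) = u" "\<And>u. u \<in> points (total B) \<Longrightarrow> \<phi> (\<psi> u) = u"
    "\<And>x. x \<in> points (base B) \<Longrightarrow> g (f x) = x" "\<And>x. x \<in> points (base B) \<Longrightarrow> f (g x) = x"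
    and ext: "\<phi> \<in> extensional (points (total B))" "f \<in> extensional (points (base B))"
    using assms by (rule Aut_pairsE) blast
  note D\<phi> = total.mem_DiffI[OF ext(1) bundle_morphismD(1)[OF \<phi>] bundle_morphismD(1)[OF \<psi>] inv(1,2)]
  note Df = base.mem_DiffI[OF ext(2) bundle_morphismD(2)[OF \<phi>] bundle_morphismD(2)[OF \<psi>] inv(3,4)]
  show \<phi>': "\<phi> \<in> carrier (Diff (total B))"
    by (rule D\<phi>(1))
  show f': "f \<in> carrier (Diff (base B))"
    by (rule Df(1))
  show "bundle_morphism K B B \<phi> f"
    by (rule \<phi>)
  show "bundle_morphism K B B (inv\<^bsub>Diff (total B)\<^esub> \<phi>) (inv\<^bsub>Diff (base B)\<^esub> f)"
    by (rule bundle_morphism_cong[OF \<psi>])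
      (simp_all add: total.inv_Diff[OF \<phi>'] base.inv_Diff[OF f'] D\<phi>(2) Df(2))
qed

lemma Aut_pairsI:
  assumes \<phi>: "\<phi> \<in> carrier (Diff (total B))" and f: "f \<in> carrier (Diff (base B))"
    and "bundle_morphism K B B \<phi> f"
    and "bundle_morphism K B B (inv\<^bsub>Diff (total B)\<^esub> \<phi>) (inv\<^bsub>Diff (base B)\<^esub> f)"
  shows "(\<phi>, f) \<in> Aut_pairs K B"
proof -
  have "\<phi> \<in> extensional (points (total B))" "f \<in> extensional (points (base B))"
    using \<phi> f by (simp_all add: mem_Diff Bij_def)
  moreover have "(inv\<^bsub>Diff (total B)\<^esub> \<phi>) (\<phi> u) = u" "\<phi> ((inv\<^bsub>Diff (total B)\<^esub> \<phi>) u) = u"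
    if "u \<in> points (total B)" for u
    using that by (simp_all add: total.inv_Diff[OF \<phi>] Diff_inv_into[OF \<phi>] Diff_closed[OF \<phi>])
  moreover have "(inv\<^bsub>Diff (base B)\<^esub> f) (f x) = x" "f ((inv\<^bsub>Diff (base B)\<^esub> f) x) = x"
    if "x \<in> points (base B)" for x
    using that by (simp_all add: base.inv_Diff[OF f] Diff_inv_into[OF f] Diff_closed[OF f])
  ultimately show ?thesis
    unfolding Aut_pairs_def using assms(3,4) by blast
qed

lemma bundle_morphism_mult:
  assumes "\<phi> \<in> carrier (Diff (total B))" "\<psi> \<in> carrier (Diff (total B))"
    and "f \<in> carrier (Diff (base B))" "g \<in> carrier (Diff (base B))"
    and \<phi>: "bundle_morphism K B B \<phi> f" and \<psi>: "bundle_morphism K B B \<psi> g"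
  shows "bundle_morphism K B B (\<phi> \<otimes>\<^bsub>Diff (total B)\<^esub> \<psi>) (f \<otimes>\<^bsub>Diff (base B)\<^esub> g)"
  by (rule bundle_morphism_cong[OF bundle_morphism_comp[OF \<psi> \<phi>]])
    (simp_all add: mult_Diff assms compose_eq)

lemma Aut_pairs_one: "(\<one>\<^bsub>Diff (total B)\<^esub>, \<one>\<^bsub>Diff (base B)\<^esub>) \<in> Aut_pairs K B"
proof -
  have "bundle_morphism K B B \<one>\<^bsub>Diff (total B)\<^esub> \<one>\<^bsub>Diff (base B)\<^esub>"
    by (rule bundle_morphism_cong[OF bundle_morphism_id]) (simp_all add: one_Diff)
  then show ?thesis
    by (intro Aut_pairsI) simp_all
qed

lemma Aut_pairs_inv:
  assumes "(\<phi>, f) \<in> Aut_pairs K B"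
  shows "(inv\<^bsub>Diff (total B)\<^esub> \<phi>, inv\<^bsub>Diff (base B)\<^esub> f) \<in> Aut_pairs K B"
  using Aut_pairs_Diff[OF assms] by (intro Aut_pairsI) simp_all

lemma Aut_pairs_mult:
  assumes "(\<phi>, f) \<in> Aut_pairs K B" "(\<psi>, g) \<in> Aut_pairs K B"
  shows "(\<phi> \<otimes>\<^bsub>Diff (total B)\<^esub> \<psi>, f \<otimes>\<^bsub>Diff (base B)\<^esub> g) \<in> Aut_pairs K B"
  using Aut_pairs_Diff[OF assms(1)] Aut_pairs_Diff[OF assms(2)]
  \<comment> \<open>The inverse of a product is the product of the inverses in the opposite order,
    so one lemma on products handles both directions.\<close>
  by (intro Aut_pairsI) (simp_all add: DT.inv_mult_group DB.inv_mult_group bundle_morphism_mult)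

lemma Aut_pairs_proj:
  assumes "(\<phi>, f) \<in> Aut_pairs K B" "u \<in> points (total B)"
  shows "proj B (\<phi> u) = f (proj B u)"
  using bundle_morphismD(3)[OF Aut_pairs_Diff(3)] assms by blast

section \<open>The base component and the three groups\<close>

lemma base_part_eq:
  assumes "(\<phi>, f) \<in> Aut_pairs K B"
  shows "base_part K B \<phi> = f"
  unfolding base_part_def
proof (rule the_equality)
  show "(\<phi>, f) \<in> Aut_pairs K B"
    by (rule assms)
  fix g assume g: "(\<phi>, g) \<in> Aut_pairs K B"
  have "g x = f x" if "x \<in> points (base B)" for x
  proof -
    obtain u where "u \<in> points (total B)" "x = proj B u"
      using \<open>x \<in> points (base B)\<close> proj_onto by auto
    with Aut_pairs_proj[OF g] Aut_pairs_proj[OF assms] show ?thesis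
      by metis
  qed
  \<comment> \<open>Off the base both maps are \<open>undefined\<close>, so agreement on the base is
    equality.\<close>
  moreover have "g \<in> extensional (points (base B))" "f \<in> extensional (points (base B))"
    using g assms by (auto simp: Aut_pairs_def)
  ultimately show "g = f"
    by (intro extensionalityI)
qed

text \<open>Uniqueness of the base component turns membership into a statement about one definite
  pair, to which the closure results for pairs apply.\<close>

lemma mem_Aut_set: "\<phi> \<in> Aut_set K B \<longleftrightarrow> (\<phi>, base_part K B \<phi>) \<in> Aut_pairs K B"
  using base_part_eq by (force simp: Aut_set_def)

lemma mem_GL_set: "\<phi> \<in> GL_set K B \<longleftrightarrow> (\<phi>, \<one>\<^bsub>Diff (base B)\<^esub>) \<in> Aut_pairs K B"
  by (simp add: GL_set_def one_Diff)

lemma mem_GE_set: "f \<in> GE_set K B \<longleftrightarrow> (\<exists>\<phi>. (\<phi>, f) \<in> Aut_pairs K B)"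
  by (force simp: GE_set_def)

lemma subgroup_Aut_set: "subgroup (Aut_set K B) (Diff (total B))"
proof (rule DT.subgroupI)
  show "Aut_set K B \<subseteq> carrier (Diff (total B))"
    using Aut_pairs_Diff(1) by (auto simp: mem_Aut_set)
  show "Aut_set K B \<noteq> {}"
    using Aut_pairs_one by (force simp: Aut_set_def)
  show "inv\<^bsub>Diff (total B)\<^esub> \<phi> \<in> Aut_set K B" if "\<phi> \<in> Aut_set K B" for \<phi>
    using Aut_pairs_inv base_part_eq that by (metis mem_Aut_set)
  show "\<phi> \<otimes>\<^bsub>Diff (total B)\<^esub> \<psi> \<in> Aut_set K B" if "\<phi> \<in> Aut_set K B" "\<psi> \<in> Aut_set K B" for \<phi> \<psi>
    using Aut_pairs_mult base_part_eq that by (metis mem_Aut_set)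
qed

lemma subgroup_GL_set: "subgroup (GL_set K B) (Diff (total B))"
proof (rule DT.subgroupI)
  show "GL_set K B \<subseteq> carrier (Diff (total B))"
    using Aut_pairs_Diff(1) by (auto simp: mem_GL_set)
  show "GL_set K B \<noteq> {}"
    using Aut_pairs_one mem_GL_set by blast
  show "inv\<^bsub>Diff (total B)\<^esub> \<phi> \<in> GL_set K B" if "\<phi> \<in> GL_set K B" for \<phi>
    using Aut_pairs_inv that by (fastforce simp: mem_GL_set)
  show "\<phi> \<otimes>\<^bsub>Diff (total B)\<^esub> \<psi> \<in> GL_set K B" if "\<phi> \<in> GL_set K B" "\<psi> \<in> GL_set K B" for \<phi> \<psi>
    using Aut_pairs_mult that by (fastforce simp: mem_GL_set)
qed

lemma subgroup_GE_set: "subgroup (GE_set K B) (Diff (base B))"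
proof (rule DB.subgroupI)
  show "GE_set K B \<subseteq> carrier (Diff (base B))"
    using Aut_pairs_Diff(2) by (auto simp: mem_GE_set)
  show "GE_set K B \<noteq> {}"
    using Aut_pairs_one mem_GE_set by blast
  show "inv\<^bsub>Diff (base B)\<^esub> f \<in> GE_set K B" if "f \<in> GE_set K B" for f
    using Aut_pairs_inv that by (auto simp: mem_GE_set)
  show "f \<otimes>\<^bsub>Diff (base B)\<^esub> g \<in> GE_set K B" if "f \<in> GE_set K B" "g \<in> GE_set K B" for f g
    using Aut_pairs_mult that unfolding mem_GE_set by blast
qed

lemma base_part_mem: "\<phi> \<in> Aut_set K B \<Longrightarrow> base_part K B \<phi> \<in> GE_set K B"
  by (auto simp: mem_Aut_set mem_GE_set)

lemma GL_subset_Aut: "GL_set K B \<subseteq> Aut_set K B"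
  by (auto simp: mem_GL_set mem_Aut_set base_part_eq)

text \<open>Multiplicativity of \<open>base_part\<close> is closure of pairs under products combined
  with uniqueness of the base component. An element of the kernel is one whose pair has the unit as
  base component, which is membership in \<open>GL_set\<close>.\<close>

lemma short_exact_Aut:
  "short_exact ((Diff (total B))\<lparr>carrier := GL_set K B\<rparr>)
     ((Diff (total B))\<lparr>carrier := Aut_set K B\<rparr>) ((Diff (base B))\<lparr>carrier := GE_set K B\<rparr>)
     (\<lambda>\<phi>. \<phi>) (base_part K B)"
  unfolding short_exact_def
proof (intro conjI)
  show "group ((Diff (total B))\<lparr>carrier := GL_set K B\<rparr>)"
    by (rule DT.subgroup_imp_group[OF subgroup_GL_set])
  show "group ((Diff (total B))\<lparr>carrier := Aut_set K B\<rparr>)"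
    by (rule DT.subgroup_imp_group[OF subgroup_Aut_set])
  show "group ((Diff (base B))\<lparr>carrier := GE_set K B\<rparr>)"
    by (rule DB.subgroup_imp_group[OF subgroup_GE_set])
  show "(\<lambda>\<phi>. \<phi>) \<in> mon ((Diff (total B))\<lparr>carrier := GL_set K B\<rparr>)
      ((Diff (total B))\<lparr>carrier := Aut_set K B\<rparr>)"
    using GL_subset_Aut by (auto simp: mon_def hom_def)
  have "base_part K B (\<phi> \<otimes>\<^bsub>Diff (total B)\<^esub> \<psi>) = base_part K B \<phi> \<otimes>\<^bsub>Diff (base B)\<^esub> base_part K B \<psi>"
    if "\<phi> \<in> Aut_set K B" "\<psi> \<in> Aut_set K B" for \<phi> \<psi>
    using that by (intro base_part_eq Aut_pairs_mult) (simp_all add: mem_Aut_set)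
  moreover have "base_part K B ` Aut_set K B = GE_set K B"
  proof
    show "base_part K B ` Aut_set K B \<subseteq> GE_set K B"
      using base_part_mem by blast
    show "GE_set K B \<subseteq> base_part K B ` Aut_set K B"
    proof
      fix f assume "f \<in> GE_set K B"
      then obtain \<phi> where \<phi>: "(\<phi>, f) \<in> Aut_pairs K B"
        by (auto simp: mem_GE_set)
      then show "f \<in> base_part K B ` Aut_set K B"
        using base_part_eq[OF \<phi>] by (auto simp: mem_Aut_set intro!: rev_image_eqI[of \<phi>])
    qed
  qed
  ultimately show "base_part K B \<in> epi ((Diff (total B))\<lparr>carrier := Aut_set K B\<rparr>)
      ((Diff (base B))\<lparr>carrier := GE_set K B\<rparr>)"
    using base_part_mem by (simp add: epi_def hom_def)
  show "kernel ((Diff (total B))\<lparr>carrier := Aut_set K B\<rparr>) ((Diff (base B))\<lparr>carrier := GE_set K B\<rparr>)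
      (base_part K B) = (\<lambda>\<phi>. \<phi>) ` carrier ((Diff (total B))\<lparr>carrier := GL_set K B\<rparr>)"
  proof -
    have "\<phi> \<in> Aut_set K B \<and> base_part K B \<phi> = \<one>\<^bsub>Diff (base B)\<^esub> \<longleftrightarrow> \<phi> \<in> GL_set K B" for \<phi>
      using base_part_eq[of \<phi> "\<one>\<^bsub>Diff (base B)\<^esub>"] by (auto simp: mem_Aut_set mem_GL_set)
    then show ?thesis
      by (auto simp: kernel_def)
  qed
qed

section \<open>Smoothness of the projection to the base\<close>

lemma smooth_base_part:
  "smooth_map (subset_space (Diff_space (total B)) (Aut_set K B))
     (subset_space (Diff_space (base B)) (GE_set K B)) (base_part K B)"
proof (rule smooth_mapI)
  show "base_part K B \<in> points (subset_space (Diff_space (total B)) (Aut_set K B)) \<rightarrow>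
      points (subset_space (Diff_space (base B)) (GE_set K B))"
    using base_part_mem by (simp add: subset_space_def)
  fix n U \<rho> assume "(n, U, \<rho>) \<in> plots (subset_space (Diff_space (total B)) (Aut_set K B))"
  then have U: "openin (Euclidean_space n) U" and \<rho>: "\<rho> \<in> U \<rightarrow>\<^sub>E Aut_set K B"
    and fam: "smooth_family (total B) n U \<rho>"
      "smooth_family (total B) n U (\<lambda>u. inv_into (points (total B)) (\<rho> u))"
    by (auto simp: subset_space_def plots_Diff_space)
  define \<tau> where "\<tau> = compose U (base_part K B) \<rho>"
  have pair: "(\<rho> u, \<tau> u) \<in> Aut_pairs K B" if "u \<in> U" for u
    using \<rho> that by (auto simp: \<tau>_def compose_eq mem_Aut_set)
  note push = smooth_family_subduction[OF total.diffeological_space_axioms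
      base.diffeological_space_axioms smooth_proj subduction_proj proj_onto U]
  have "smooth_family (base B) n U \<tau>"
    by (rule push[OF fam(1)]) (use Aut_pairs_proj[OF pair] in auto)
  moreover have "smooth_family (base B) n U (\<lambda>u. inv_into (points (base B)) (\<tau> u))"
  \<comment> \<open>The inverses form an automorphism pair too, so they satisfy the same
    intertwining relation; the group inverses then have to be rewritten as
    \<open>inv_into\<close>.\<close>
  proof (rule push[OF fam(2)])
    fix u e assume u: "u \<in> U" and e: "e \<in> points (total B)"
    note D = Aut_pairs_Diff[OF pair[OF u]]
    have "proj B e \<in> points (base B)"
      using e proj_onto by auto
    with Aut_pairs_proj[OF Aut_pairs_inv[OF pair[OF u]] e] e
    show "proj B (inv_into (points (total B)) (\<rho> u) e) = inv_into (points (base B)) (\<tau> u) (proj B e)"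
      by (simp add: total.inv_Diff D base.inv_Diff)
  qed
  moreover have "\<tau> \<in> U \<rightarrow>\<^sub>E GE_set K B"
  proof
    show "\<tau> u \<in> GE_set K B" if "u \<in> U" for u
      using pair[OF that] unfolding mem_GE_set by blast
  qed (simp add: \<tau>_def compose_def)
  \<comment> \<open>A plot of the subset space is first of all a plot of the ambient group, so the
    values must be seen in \<open>Diff (base B)\<close>.\<close>
  moreover have "GE_set K B \<subseteq> carrier (Diff (base B))"
    using subgroup.subset[OF subgroup_GE_set] .
  ultimately show "(n, U, compose U (base_part K B) \<rho>) \<in>
      plots (subset_space (Diff_space (base B)) (GE_set K B))"
    using U by (auto simp: subset_space_def plots_Diff_space \<tau>_def[symmetric])
qed

end

text \<open>Since \<open>base_part\<close> is a \<open>THE\<close>-term, the conjunct on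
  \<open>Aut_pairs\<close> certifies that it is the second projection. Smoothness of both maps makes
  this a sequence of diffeological groups and not only of abstract ones.\<close>

theorem theorem4p2:
  fixes K :: "('k, 'm) ring_scheme" and KD :: "'k dspace"
    and B :: "('k, 'e, 'x) pseudo_bundle"
  assumes "vector_pseudo_bundle K KD B"
  shows "diffeological_subgroup (Aut_set K B) (Diff (total B)) (Diff_space (total B)) \<and>
    diffeological_subgroup (GL_set K B) (Diff (total B)) (Diff_space (total B)) \<and>
    diffeological_subgroup (GE_set K B) (Diff (base B)) (Diff_space (base B)) \<and>
    (\<forall>(\<phi>, f) \<in> Aut_pairs K B. base_part K B \<phi> = f) \<and>
    short_exact ((Diff (total B))\<lparr>carrier := GL_set K B\<rparr>)
      ((Diff (total B))\<lparr>carrier := Aut_set K B\<rparr>)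
      ((Diff (base B))\<lparr>carrier := GE_set K B\<rparr>)
      (\<lambda>\<phi>. \<phi>) (base_part K B) \<and>
    smooth_map (subset_space (Diff_space (total B)) (GL_set K B))
      (subset_space (Diff_space (total B)) (Aut_set K B)) (\<lambda>\<phi>. \<phi>) \<and>
    smooth_map (subset_space (Diff_space (total B)) (Aut_set K B))
      (subset_space (Diff_space (base B)) (GE_set K B)) (base_part K B)"
proof (intro conjI)
  interpret vector_pseudo_bundle K KD B by fact
  interpret total: diffeological_space "total B"
    using assms by (simp add: vector_pseudo_bundle_def)
  interpret base: diffeological_space "base B"
    using assms by (simp add: vector_pseudo_bundle_def)
  show "diffeological_subgroup (Aut_set K B) (Diff (total B)) (Diff_space (total B))"
    by (rule diffeological_subgroupI[OF total.diffeological_group_Diff subgroup_Aut_set])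
  show "diffeological_subgroup (GL_set K B) (Diff (total B)) (Diff_space (total B))"
    by (rule diffeological_subgroupI[OF total.diffeological_group_Diff subgroup_GL_set])
  show "diffeological_subgroup (GE_set K B) (Diff (base B)) (Diff_space (base B))"
    by (rule diffeological_subgroupI[OF base.diffeological_group_Diff subgroup_GE_set])
  show "\<forall>(\<phi>, f) \<in> Aut_pairs K B. base_part K B \<phi> = f"
    using base_part_eq by blast
  show "short_exact ((Diff (total B))\<lparr>carrier := GL_set K B\<rparr>)
      ((Diff (total B))\<lparr>carrier := Aut_set K B\<rparr>)
      ((Diff (base B))\<lparr>carrier := GE_set K B\<rparr>)
      (\<lambda>\<phi>. \<phi>) (base_part K B)"
    by (rule short_exact_Aut)
  have "GL_set K B \<subseteq> points (Diff_space (total B))"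
    using subgroup.subset[OF subgroup_GL_set] by simp
  then show "smooth_map (subset_space (Diff_space (total B)) (GL_set K B))
      (subset_space (Diff_space (total B)) (Aut_set K B)) (\<lambda>\<phi>. \<phi>)"
    using GL_subset_Aut
    by (intro smooth_map_subset_space
        diffeological_space.smooth_map_id[OF total.diffeological_Diff_space]) auto
  show "smooth_map (subset_space (Diff_space (total B)) (Aut_set K B))
      (subset_space (Diff_space (base B)) (GE_set K B)) (base_part K B)"
    by (rule smooth_base_part)
qed

end
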